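(* Let $\eta$ and $\theta$ be two inner functions and let $A:\eta H^2\to K_\theta$ be a bounded linear operator. Then $A\mathcal{S}_{(\eta)}=S_\theta A$ if and only if $A=\mathcal{T}_\phi$ for some $\phi\in\bar\eta H^\infty$.
   Context: $H^2$ is the Hardy space, viewed as a closed subspace of $L^2=L^2(\mathbb{T})$; $H^\infty=L^\infty(\mathbb{T})\cap H^2$. For an inner function $\theta$, $K_\theta=H^2\ominus\theta H^2$ is the model space and $P_\theta:L^2\to K_\theta$ the orthogonal projection. $S$ is the shift $Sf=zf$ on $H^2$; $S_\theta=P_\theta S|_{K_\theta}$; $\mathcal{S}_{(\eta)}=P_{\eta H^2}S|_{\eta H^2}$, i.e. multiplication by $z$ on $\eta H^2$. For $\phi\in L^\infty(\mathbb{T})$, the restricted Toeplitz operator is $\mathcal{T}_\phi:\eta H^2\to K_\theta$, $\mathcal{T}_\phi(h)=P_\theta(\phi h)$. *)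

theory Defs
  imports "HOL-Analysis.Analysis"
begin

definition circle_measure :: "complex measure" where
  "circle_measure = distr (uniform_measure lborel {0..2 * pi}) borel cis"

lemma sets_circle_measure [simp, measurable_cong]: "sets circle_measure = sets borel"
  by (simp add: circle_measure_def)

lemma space_circle_measure [simp]: "space circle_measure = UNIV"
  by (simp add: circle_measure_def)

lemma emeasure_circle_measure_UNIV: "emeasure circle_measure UNIV = 1"
proof -
  have "cis \<in> borel_measurable borel"
    by (intro borel_measurable_continuous_onI continuous_intros)
  then show ?thesis
    by (simp add: circle_measure_def emeasure_distr emeasure_uniform_measure
        divide_ennreal)
qed

text \<open>
  Measurable functions on the unit circle modulo equality almost everywhere.
  They form a commutative ring that contains \<open>L\<^sup>2\<close> and \<open>L\<^sup>\<infinity>\<close> as subsets; functions are defined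
  on the whole plane, but the measure is concentrated on the circle.
\<close>

definition ae_eq :: "(complex \<Rightarrow> complex) \<Rightarrow> (complex \<Rightarrow> complex) \<Rightarrow> bool" where
  "ae_eq f g \<longleftrightarrow> f \<in> borel_measurable circle_measure \<and> g \<in> borel_measurable circle_measure \<and>
     (AE z in circle_measure. f z = g z)"

quotient_type circle_fun = "complex \<Rightarrow> complex" / partial: ae_eq
proof (rule part_equivpI)
  show "\<exists>x. ae_eq x x"
    by (rule exI[of _ "\<lambda>_. 0"]) (simp add: ae_eq_def)
  show "symp ae_eq"
    by (auto simp: symp_def ae_eq_def)
  show "transp ae_eq"
    unfolding transp_def ae_eq_def by auto
qed

instantiation circle_fun :: comm_ring_1
begin

lift_definition zero_circle_fun :: circle_fun is "\<lambda>_. 0"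
  by (simp add: ae_eq_def)

lift_definition one_circle_fun :: circle_fun is "\<lambda>_. 1"
  by (simp add: ae_eq_def)

lift_definition plus_circle_fun :: "circle_fun \<Rightarrow> circle_fun \<Rightarrow> circle_fun"
  is "\<lambda>f g z. f z + g z"
  by (auto simp: ae_eq_def)

lift_definition minus_circle_fun :: "circle_fun \<Rightarrow> circle_fun \<Rightarrow> circle_fun"
  is "\<lambda>f g z. f z - g z"
  by (auto simp: ae_eq_def)

lift_definition uminus_circle_fun :: "circle_fun \<Rightarrow> circle_fun"
  is "\<lambda>f z. - f z"
  by (auto simp: ae_eq_def)

lift_definition times_circle_fun :: "circle_fun \<Rightarrow> circle_fun \<Rightarrow> circle_fun"
  is "\<lambda>f g z. f z * g z"
  by (auto simp: ae_eq_def)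

instance
proof
  fix a b c :: circle_fun
  show "a * b * c = a * (b * c)" by transfer (auto simp: ae_eq_def algebra_simps)
  show "a * b = b * a" by transfer (auto simp: ae_eq_def algebra_simps)
  show "1 * a = a" by transfer (auto simp: ae_eq_def)
  show "a + b + c = a + (b + c)" by transfer (auto simp: ae_eq_def algebra_simps)
  show "a + b = b + a" by transfer (auto simp: ae_eq_def algebra_simps)
  show "0 + a = a" by transfer (auto simp: ae_eq_def)
  show "- a + a = 0" by transfer (auto simp: ae_eq_def)
  show "a - b = a + - b" by transfer (auto simp: ae_eq_def)
  show "(a + b) * c = a * c + b * c" by transfer (auto simp: ae_eq_def algebra_simps)
  show "(0::circle_fun) \<noteq> 1"
  proof transfer
    have "\<not> (AE z in circle_measure. False)"
      using emeasure_circle_measure_UNIV by (simp add: AE_iff_null null_sets_def)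
    then show "\<not> ae_eq (\<lambda>_. 0) (\<lambda>_. 1)"
      by (simp add: ae_eq_def)
  qed
qed

end

lift_definition cscale :: "complex \<Rightarrow> circle_fun \<Rightarrow> circle_fun"
  is "\<lambda>c f z. c * f z"
  by (auto simp: ae_eq_def)

lift_definition conj_fun :: "circle_fun \<Rightarrow> circle_fun"
  is "\<lambda>f z. cnj (f z)"
  by (auto simp: ae_eq_def
      intro: borel_measurable_continuous_on[OF continuous_on_cnj[OF continuous_on_id]])

lift_definition coord :: circle_fun is "\<lambda>z. z"
  by (simp add: ae_eq_def)

lift_definition circle_integral :: "circle_fun \<Rightarrow> complex"
  is "\<lambda>f. \<integral>z. f z \<partial>circle_measure"
  by (auto simp: ae_eq_def intro: integral_cong_AE)

lift_definition fourier_coeff :: "circle_fun \<Rightarrow> int \<Rightarrow> complex"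
  is "\<lambda>f n. \<integral>z. f z * z powi (- n) \<partial>circle_measure"
  by (auto simp: ae_eq_def fun_eq_iff power_int_def intro!: integral_cong_AE)

lift_definition square_integrable :: "circle_fun \<Rightarrow> bool"
  is "\<lambda>f. integrable circle_measure (\<lambda>z. (cmod (f z))\<^sup>2)"
proof -
  fix f g assume "ae_eq f g"
  then have [measurable]: "f \<in> borel_measurable circle_measure" "g \<in> borel_measurable circle_measure"
    and "AE z in circle_measure. f z = g z"
    by (auto simp: ae_eq_def)
  then show "integrable circle_measure (\<lambda>z. (cmod (f z))\<^sup>2) =
      integrable circle_measure (\<lambda>z. (cmod (g z))\<^sup>2)"
    by (intro integrable_cong_AE) auto
qed

lift_definition essentially_bounded :: "circle_fun \<Rightarrow> bool"
  is "\<lambda>f. \<exists>C. AE z in circle_measure. cmod (f z) \<le> C"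
proof -
  fix f g assume "ae_eq f g"
  then have "AE z in circle_measure. f z = g z"
    by (simp add: ae_eq_def)
  then have "(AE z in circle_measure. cmod (f z) \<le> C) \<longleftrightarrow> (AE z in circle_measure. cmod (g z) \<le> C)" for C
    by auto
  then show "(\<exists>C. AE z in circle_measure. cmod (f z) \<le> C) =
      (\<exists>C. AE z in circle_measure. cmod (g z) \<le> C)"
    by simp
qed

lift_definition unimodular :: "circle_fun \<Rightarrow> bool"
  is "\<lambda>f. AE z in circle_measure. cmod (f z) = 1"
  by (auto simp: ae_eq_def)

definition L2 :: "circle_fun set" where
  "L2 = {f. square_integrable f}"

definition Linf :: "circle_fun set" where
  "Linf = {f. essentially_bounded f}"

text \<open>\<open>H\<^sup>2\<close> is given by its boundary functions.\<close>

definition H2 :: "circle_fun set" where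
  "H2 = {f \<in> L2. \<forall>n<0. fourier_coeff f n = 0}"

definition Hinf :: "circle_fun set" where
  "Hinf = Linf \<inter> H2"

definition inner_function :: "circle_fun \<Rightarrow> bool" where
  "inner_function \<theta> \<longleftrightarrow> \<theta> \<in> Hinf \<and> unimodular \<theta>"

text \<open>The integral defining \<open>cinner f g\<close> converges when \<open>f\<close> and \<open>g\<close> are in \<open>L\<^sup>2\<close>; otherwise it may be a junk value.\<close>

definition cinner :: "circle_fun \<Rightarrow> circle_fun \<Rightarrow> complex" where
  "cinner f g = circle_integral (f * conj_fun g)"

definition L2_norm :: "circle_fun \<Rightarrow> real" where
  "L2_norm f = sqrt (Re (cinner f f))"

definition mult_image :: "circle_fun \<Rightarrow> circle_fun set \<Rightarrow> circle_fun set" where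
  "mult_image \<phi> M = (\<lambda>f. \<phi> * f) ` M"

definition orth_diff :: "circle_fun set \<Rightarrow> circle_fun set \<Rightarrow> circle_fun set" where
  "orth_diff M N = {f \<in> M. \<forall>g\<in>N. cinner f g = 0}"

definition model_space :: "circle_fun \<Rightarrow> circle_fun set" where
  "model_space \<theta> = orth_diff H2 (mult_image \<theta> H2)"

text \<open>The orthogonal projection of \<open>L\<^sup>2\<close> onto \<open>M\<close>; meaningful for \<open>f \<in> L\<^sup>2\<close> and a closed subspace \<open>M\<close>.\<close>

definition orth_proj :: "circle_fun set \<Rightarrow> circle_fun \<Rightarrow> circle_fun" where
  "orth_proj M f = (THE g. g \<in> M \<and> (\<forall>h\<in>M. cinner (f - g) h = 0))"

definition shift :: "circle_fun \<Rightarrow> circle_fun" where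
  "shift f = coord * f"

text \<open>Operators between subspaces are total functions of which only the values on the domain matter.\<close>

definition model_shift :: "circle_fun \<Rightarrow> circle_fun \<Rightarrow> circle_fun" where
  "model_shift \<theta> f = orth_proj (model_space \<theta>) (shift f)"

definition restricted_shift :: "circle_fun \<Rightarrow> circle_fun \<Rightarrow> circle_fun" where
  "restricted_shift \<eta> f = orth_proj (mult_image \<eta> H2) (shift f)"

definition restricted_toeplitz :: "circle_fun \<Rightarrow> circle_fun \<Rightarrow> circle_fun \<Rightarrow> circle_fun" where
  "restricted_toeplitz \<theta> \<phi> h = orth_proj (model_space \<theta>) (\<phi> * h)"

definition bounded_operator ::
  "circle_fun set \<Rightarrow> circle_fun set \<Rightarrow> (circle_fun \<Rightarrow> circle_fun) \<Rightarrow> bool" where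
  "bounded_operator M N A \<longleftrightarrow>
     (\<forall>f\<in>M. A f \<in> N) \<and>
     (\<forall>f\<in>M. \<forall>g\<in>M. A (f + g) = A f + A g) \<and>
     (\<forall>c. \<forall>f\<in>M. A (cscale c f) = cscale c (A f)) \<and>
     (\<exists>C. \<forall>f\<in>M. L2_norm (A f) \<le> C * L2_norm f)"

end

theory Submission
  imports Defs "HOL-Computational_Algebra.Formal_Power_Series" "HOL-Real_Asymp.Real_Asymp"
begin

text \<open>
  The operator \<open>B f = A (\<eta> f)\<close> intertwines the shift of \<open>H\<^sup>2\<close> with the compressed shift, so Sarason's theorem applies:
  \<open>B f = P\<^sub>\<theta> (\<psi> f)\<close> for some \<open>\<psi>\<close> in \<open>H\<^sup>\<infinity>\<close>, and \<open>\<phi>\<close> is the conjugate of \<open>\<eta>\<close> times \<open>\<psi>\<close>. Multiplying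
  by the conjugate of \<open>\<theta>\<close> turns \<open>B\<close> into a bounded Hankel operator, whose symbol \<open>u\<close> is supplied by Nehari's theorem, and
  \<open>\<psi> = \<theta> u\<close>. Nehari's theorem is obtained without factorisation in \<open>H\<^sup>1\<close>: Fejer averages of the
  Hankel matrix are triangular Toeplitz contractions, Schur's algorithm extends each of them to a function in the
  unit ball of \<open>H\<^sup>\<infinity>\<close>, and a weak limit of these functions is the symbol.
\<close>

section \<open>The trigonometric system\<close>

text \<open>The Hankel matrix comes from working modulo \<open>\<theta> * h\<close> with
  \<open>h\<close> in \<open>H2\<close>: multiplication by the conjugate of \<theta> turns this
  error into \<open>h\<close>, which has no Fourier coefficients at negative indices. There the
  shift acts exactly, and the coefficient at -(i + 1) of the image of z^j depends on i + j only.

  The averages are forced by the passage from Hankel to triangular matrices. Reversing the rows of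
  an N by N corner gives a Toeplitz matrix, Schur's algorithm reads only its lower triangle, and
  cutting to the triangle is not bounded uniformly in N. With Fejer weights the cut does not
  increase the norm, and the weights tend to 1 as N grows.

  Analyticity has two forms: boundary functions whose negative coefficients vanish, where essential
  bounds are checked pointwise, and formal power series, where interpolation conditions become
  divisibility by powers of \<open>fps_X\<close>. No values inside the disc occur.
  \<open>circle_fun\<close> is a ring without division, so quotients of boundary functions are
  replaced by equations.\<close>

interpretation circle: finite_measure circle_measure
  by (rule finite_measureI) (simp add: emeasure_circle_measure_UNIV)

lemma measure_circle_UNIV: "measure circle_measure UNIV = 1"
  by (simp add: measure_def emeasure_circle_measure_UNIV)

lemma cis_borel [measurable]: "cis \<in> borel_measurable borel"
  by (intro borel_measurable_continuous_onI continuous_intros)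

lemma cnj_borel [measurable]: "cnj \<in> borel_measurable borel"
  by (intro borel_measurable_continuous_onI continuous_intros)

lemma powi_borel [measurable]: "(\<lambda>z::complex. z powi n) \<in> borel_measurable borel"
  by (cases "n \<ge> 0") (auto simp: power_int_def)

text \<open>Representatives of a \<open>circle_fun\<close> live on the whole plane; this is what
  allows z to be treated as nonzero, with inverse \<open>cnj z\<close>, in every almost-everywhere
  argument.\<close>

lemma AE_circle_norm: "AE z in circle_measure. cmod z = 1"
  unfolding circle_measure_def by (subst AE_distr_iff) auto

lemma integral_circle_powi:
  "(\<integral>z. z powi n \<partial>circle_measure) = (if n = 0 then 1 else 0)"
proof (cases "n = 0")
  case True
  then show ?thesis by (simp add: measure_circle_UNIV)
next
  case False
  let ?F = "\<lambda>x. cis (of_int n * x) / (\<i> * of_int n)"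
  have der: "(?F has_vector_derivative cis (of_int n * x)) (at x within S)" for x S
    using False by (auto simp: has_vector_derivative_def intro!: derivative_eq_intros ext)
      (auto simp: field_simps scaleR_conv_of_real)
  have "(\<integral>z. z powi n \<partial>circle_measure) = 
      (\<integral>x. cis (of_int n * x) \<partial>uniform_measure lborel {0..2 * pi})"
    unfolding circle_measure_def
    by (subst integral_distr) (auto simp: cis_power_int)
  also have "\<dots> = (\<integral>x. indicator {0..2*pi} x *\<^sub>R cis (of_int n * x) \<partial>lborel) / (2 * pi)"
  proof -
    have "uniform_measure lborel {0..2 * pi} = density lborel (\<lambda>x. ennreal (indicator {0..2*pi} x / (2 * pi)))"
      unfolding uniform_measure_def
      by (rule density_cong) (auto simp: indicator_def divide_ennreal ennreal_1[symmetric] simp del: ennreal_1)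
    then show ?thesis
      by (simp add: integral_density scaleR_conv_of_real)
  qed
  also have "(\<integral>x. indicator {0..2*pi} x *\<^sub>R cis (of_int n * x) \<partial>lborel) = ?F (2 * pi) - ?F 0"
    by (intro integral_FTC_Icc der continuous_intros) auto
  also have "\<dots> = 0"
    using cis_multiple_2pi[of "of_int n"] by (simp add: mult_ac)
  finally show ?thesis using False by simp
qed

text \<open>The vanishing is extended step by step: from powers of z to real polynomials in Re z and
  Im z, then to continuous functions by Stone-Weierstrass on the circle, to closed sets by dominated
  convergence, and to Borel sets by a Dynkin argument. A function whose integral over every Borel
  set is 0 vanishes almost everywhere.\<close>

lemma trig_unique:
  assumes f: "integrable circle_measure f"
    and 0: "\<And>n. (\<integral>z. f z * z powi n \<partial>circle_measure) = 0"
  shows "AE z in circle_measure. f z = 0"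
proof -
  have [measurable]: "f \<in> borel_measurable borel"
    using f by (simp add: borel_measurable_integrable cong: measurable_cong_sets)
  let ?M = circle_measure
  have bdd: "integrable ?M (\<lambda>z. f z * g z)"
    if [measurable]: "g \<in> borel_measurable borel" and "\<And>z. cmod z = 1 \<Longrightarrow> cmod (g z) \<le> C" for g C
    by (rule Bochner_Integration.integrable_bound[of _ "\<lambda>z. C * norm (f z)"])
      (use f that in \<open>auto simp: norm_mult abs_mult mult.commute[of C]
        intro!: mult_left_mono order_trans[OF _ abs_ge_self] eventually_mono[OF AE_circle_norm]\<close>)
  \<comment> \<open>\<open>V\<close> collects the multipliers, bounded on the circle, that
    annihilate \<open>f\<close> together with all their products by powers of z. Demanding all n at
    once makes \<open>V\<close> stable under multiplication by powers of z.\<close>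
  define V where "V = {p. p \<in> borel_measurable borel \<and> (\<exists>C. \<forall>z. cmod z = 1 \<longrightarrow> cmod (p z) \<le> C) \<and>
     (\<forall>n. (\<integral>z. f z * (p z * z powi n) \<partial>?M) = 0)}"
  have int_V: "integrable ?M (\<lambda>z. f z * (p z * z powi n))" if "p \<in> V" for p n
  proof -
    from that obtain C where [measurable]: "p \<in> borel_measurable borel"
      and C: "\<And>z. cmod z = 1 \<Longrightarrow> cmod (p z) \<le> C"
      by (auto simp: V_def)
    show ?thesis
      by (rule bdd[of _ C]) (use C in \<open>auto simp: norm_mult norm_power_int\<close>)
  qed
  have V_lin: "(\<lambda>z. c * (p z * z powi k) + d * (q z * z powi l)) \<in> V" if "p \<in> V" "q \<in> V" for p q c d k l
  proof -
    from that obtain C D where [measurable]: "p \<in> borel_measurable borel" "q \<in> borel_measurable borel"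
      and C: "\<And>z. cmod z = 1 \<Longrightarrow> cmod (p z) \<le> C" and D: "\<And>z. cmod z = 1 \<Longrightarrow> cmod (q z) \<le> D"
      and p0: "\<And>n. (\<integral>z. f z * (p z * z powi n) \<partial>?M) = 0"
      and q0: "\<And>n. (\<integral>z. f z * (q z * z powi n) \<partial>?M) = 0"
      by (auto simp: V_def)
    have "(\<integral>z. f z * ((c * (p z * z powi k) + d * (q z * z powi l)) * z powi n) \<partial>?M) = 0" for n
    proof -
      have "(\<integral>z. f z * ((c * (p z * z powi k) + d * (q z * z powi l)) * z powi n) \<partial>?M) =
          (\<integral>z. c * (f z * (p z * z powi (k + n))) + d * (f z * (q z * z powi (l + n))) \<partial>?M)"
      proof (intro integral_cong_AE)
        show "AE z in ?M. f z * ((c * (p z * z powi k) + d * (q z * z powi l)) * z powi n) =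
          c * (f z * (p z * z powi (k + n))) + d * (f z * (q z * z powi (l + n)))"
          using AE_circle_norm
        proof eventually_elim
          case (elim z)
          then have "z \<noteq> 0" by auto
          then show ?case by (simp add: power_int_add algebra_simps)
        qed
      qed auto
      also have "\<dots> = 0"
        by (simp add: int_V that p0 q0)
      finally show ?thesis .
    qed
    moreover have "cmod (c * (p z * z powi k) + d * (q z * z powi l)) \<le> cmod c * C + cmod d * D"
      if "cmod z = 1" for z
      using that C[OF that] D[OF that]
      by (intro norm_triangle_mono) (auto simp: norm_mult norm_power_int intro!: mult_left_mono)
    ultimately show ?thesis
      unfolding V_def by auto
  qed
  have one_V: "(\<lambda>z. 1) \<in> V"
    using 0 by (auto simp: V_def)
  have poly: "\<forall>h\<in>V. (\<lambda>z. complex_of_real (p z) * h z) \<in> V" if "real_polynomial_function p" for p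
    using that
  proof induction
    case (linear p)
    have p: "p z = Re z * p 1 + Im z * p \<i>" for z
    proof -
      interpret bounded_linear p by fact
      have "p z = p (Re z *\<^sub>R 1 + Im z *\<^sub>R \<i>)"
        by (rule arg_cong[of _ _ p]) (simp add: complex_eq_iff)
      then show ?thesis by (simp only: add scaleR real_scaleR_def)
    qed
    have [measurable]: "p \<in> borel_measurable borel"
      using linear by (intro borel_measurable_continuous_onI linear_continuous_on)
    show ?case
    proof
      fix h assume h: "h \<in> V"
      \<comment> \<open>On the circle Re z = (z + 1/z)/2 and Im z = \<i> (1/z - z)/2, so a real
        linear form is a combination of z and 1/z; these are its two coefficients.\<close>
      let ?q = "\<lambda>z. (p 1 - \<i> * p \<i>) / 2 * (h z * z powi 1) + (p 1 + \<i> * p \<i>) / 2 * (h z * z powi -1)"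
      have *: "of_real (p z) * h z = ?q z" if "cmod z = 1" for z
      proof -
        have "inverse z = cnj z"
          using that divide_conv_cnj[of z 1] by (simp add: field_simps)
        then have "?q z = ((z + cnj z) / 2 * p 1 + \<i> * (cnj z - z) / 2 * p \<i>) * h z"
          by (simp add: power_int_minus algebra_simps add_divide_distrib diff_divide_distrib)
        also have "(z + cnj z) / 2 = of_real (Re z)"
          by (simp add: complex_eq_iff)
        also have "\<i> * (cnj z - z) / 2 = of_real (Im z)"
          by (simp add: complex_eq_iff)
        finally show ?thesis
          by (simp add: p[of z])
      qed
      have qV: "?q \<in> V" by (rule V_lin[OF h h])
      then have "\<exists>C. \<forall>z. cmod z = 1 \<longrightarrow> cmod (of_real (p z) * h z) \<le> C"
        using * by (auto simp: V_def)
      moreover have [measurable]: "h \<in> borel_measurable borel" using h by (simp add: V_def)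
      moreover have "(\<integral>z. f z * (of_real (p z) * h z * z powi n) \<partial>?M) = (\<integral>z. f z * (?q z * z powi n) \<partial>?M)" for n
        by (intro integral_cong_AE eventually_mono[OF AE_circle_norm]) (use * in auto)
      ultimately show "(\<lambda>z. of_real (p z) * h z) \<in> V"
        using qV by (simp add: V_def)
    qed
  next
    case (const c)
    show ?case
      using V_lin[of _ _ "of_real c" 0 0 0] by fastforce
  next
    case (add p q)
    then show ?case
      using V_lin[of _ _ 1 0 1 0] by (fastforce simp: algebra_simps)
  next
    case (mult p q)
    then show ?case
      by (fastforce simp: algebra_simps)
  qed
  have cont: "(\<integral>z. f z * complex_of_real (g z) \<partial>?M) = 0" if g: "continuous_on UNIV g" for g :: "complex \<Rightarrow> real"
  proof -
    have [measurable]: "g \<in> borel_measurable borel"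
      using g by (rule borel_measurable_continuous_onI)
    have "norm (\<integral>z. f z * of_real (g z) \<partial>?M) \<le> e * (\<integral>z. norm (f z) \<partial>?M)" if "e > 0" for e
    proof -
      obtain p where p: "real_polynomial_function p" "\<And>z. z \<in> sphere 0 1 \<Longrightarrow> \<bar>g z - p z\<bar> < e"
        using Stone_Weierstrass_real_polynomial_function[of "sphere 0 1 :: complex set" g e]
          continuous_on_subset[OF g] \<open>e > 0\<close> by auto
      have [measurable]: "p \<in> borel_measurable borel"
        using p(1) by (intro borel_measurable_continuous_onI continuous_on_polymonial_function)
          (simp add: real_polynomial_function_eq)
      have pV: "(\<lambda>z. of_real (p z)) \<in> V"
        using poly[OF p(1)] one_V by fastforce
      have ip: "integrable ?M (\<lambda>z. f z * of_real (p z))" "(\<integral>z. f z * of_real (p z) \<partial>?M) = 0"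
      proof -
        have "\<forall>n. (\<integral>z. f z * (of_real (p z) * z powi n) \<partial>?M) = 0"
          using pV unfolding V_def by blast
        from this[rule_format, of 0] int_V[OF pV, of 0] show
          "integrable ?M (\<lambda>z. f z * of_real (p z))" "(\<integral>z. f z * of_real (p z) \<partial>?M) = 0"
          by (simp_all only: power_int_0_right mult.right_neutral)
      qed
      have id: "integrable ?M (\<lambda>z. f z * of_real (g z - p z))"
        by (rule bdd[of _ e]) (use p(2) in \<open>auto intro: less_imp_le simp del: of_real_diff\<close>)
      have "(\<integral>z. f z * of_real (g z) \<partial>?M) = (\<integral>z. f z * of_real (g z - p z) + f z * of_real (p z) \<partial>?M)"
        by (simp add: algebra_simps)
      also have "\<dots> = (\<integral>z. f z * of_real (g z - p z) \<partial>?M)"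
        using ip id by (subst Bochner_Integration.integral_add) auto
      also have "norm \<dots> \<le> (\<integral>z. norm (f z * of_real (g z - p z)) \<partial>?M)"
        by (rule integral_norm_bound)
      also have "\<dots> \<le> (\<integral>z. e * norm (f z) \<partial>?M)"
      proof (rule integral_mono_AE)
        show "AE z in ?M. norm (f z * of_real (g z - p z)) \<le> e * norm (f z)"
          using AE_circle_norm
        proof eventually_elim
          case (elim z)
          then show ?case
            using p(2)[of z] by (auto simp: norm_mult mult.commute[of e] simp del: of_real_diff intro!: mult_left_mono)
        qed
      qed (use f id in auto)
      finally show ?thesis by simp
    qed
    then have "norm (\<integral>z. f z * of_real (g z) \<partial>?M) \<le> 0"
      by (intro tendsto_lowerbound[of "\<lambda>e. e * (\<integral>z. norm (f z) \<partial>?M)" _ "at_right 0"])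
        (auto intro!: tendsto_eq_intros eventually_at_right_less eventually_mono[OF eventually_at_right_less])
    then show ?thesis by simp
  qed
  have ind: "(\<integral>z. indicator A z *\<^sub>R f z \<partial>?M) = 0" if "A \<in> sets borel" for A
  proof -
    have "Int_stable {S::complex set. closed S}"
      by (auto simp: Int_stable_def)
    moreover have "{S::complex set. closed S} \<subseteq> Pow UNIV" by simp
    moreover have "A \<in> sigma_sets UNIV {S. closed S}"
      using that by (simp add: borel_eq_closed)
    ultimately show ?thesis
    proof (induction rule: sigma_sets_induct_disjoint)
      case (basic S)
      then have S: "closed S" by simp
      then have [measurable]: "S \<in> sets borel" by (rule borel_closed)
      show "(\<integral>z. indicator S z *\<^sub>R f z \<partial>?M) = 0"
      \<comment> \<open>\<open>infdist z {}\<close> is 0 by convention, so the approximation by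
        distances is only correct for nonempty \<open>S\<close>.\<close>
      proof (cases "S = {}")
        case False
        \<comment> \<open>Continuous functions decreasing to the indicator of \<open>S\<close>:
          outside the closed set \<open>S\<close> the distance is positive, so they are eventually
          0.\<close>
        define g where "g k z = max 0 (1 - real k * infdist z S)" for k z
        have g_cont: "continuous_on UNIV (g k)" for k
          unfolding g_def by (intro continuous_intros)
        then have [measurable]: "g k \<in> borel_measurable borel" for k
          by (intro borel_measurable_continuous_onI)
        have lim: "(\<lambda>k. g k z) \<longlonglongrightarrow> indicator S z" for z
        proof (cases "z \<in> S")
          case True
          then show ?thesis by (simp add: g_def)
        next
          case notin: False
          then have "infdist z S > 0"
            using S False by (meson infdist_pos_not_in_closed)
          then obtain n where n: "1 < real n * infdist z S"
            using reals_Archimedean3 by blast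
          have "g k z = 0" if "k \<ge> n" for k
          proof -
            have "real n * infdist z S \<le> real k * infdist z S"
              using that by (intro mult_right_mono) (auto simp: infdist_nonneg)
            with n show ?thesis by (simp add: g_def max_def)
          qed
          then have "\<forall>\<^sub>F k in sequentially. g k z = indicator S z"
            using notin by (intro eventually_sequentiallyI[of n]) simp
          then show ?thesis by (rule tendsto_eventually)
        qed
        have "(\<lambda>k. \<integral>z. f z * complex_of_real (g k z) \<partial>?M) \<longlonglongrightarrow> (\<integral>z. indicator S z *\<^sub>R f z \<partial>?M)"
        proof (rule integral_dominated_convergence)
          show "AE z in ?M. (\<lambda>k. f z * complex_of_real (g k z)) \<longlonglongrightarrow> indicator S z *\<^sub>R f z"
            using lim by (intro AE_I2) (auto simp: scaleR_conv_of_real mult.commute intro!: tendsto_intros)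
          show "AE z in ?M. norm (f z * complex_of_real (g k z)) \<le> norm (f z)" for k
            by (intro AE_I2) (auto simp: norm_mult g_def intro!: mult_right_le_one_le mult_nonneg_nonneg infdist_nonneg)
        qed (use f in auto)
        then show ?thesis
          by (simp add: cont[OF g_cont] LIMSEQ_const_iff)
      qed simp
    next
      case empty
      show "(\<integral>z. indicator {} z *\<^sub>R f z \<partial>?M) = 0" by simp
    next
      case (compl A)
      then have [measurable]: "A \<in> sets borel" by (simp add: borel_eq_closed)
      have "(\<integral>z. indicator (UNIV - A) z *\<^sub>R f z \<partial>?M) = (\<integral>z. f z - indicator A z *\<^sub>R f z \<partial>?M)"
        by (intro Bochner_Integration.integral_cong) (auto simp: indicator_def)
      also have "\<dots> = (\<integral>z. f z \<partial>?M) - (\<integral>z. indicator A z *\<^sub>R f z \<partial>?M)"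
        using f by (intro Bochner_Integration.integral_diff integrable_mult_indicator) auto
      finally show "(\<integral>z. indicator (UNIV - A) z *\<^sub>R f z \<partial>?M) = 0"
        using compl 0[of 0] by simp
    next
      case (union A)
      then have [measurable]: "A i \<in> sets borel" for i by (auto simp add: borel_eq_closed)
      have "set_integrable ?M (\<Union>i. A i) f"
        unfolding set_integrable_def using f by (intro integrable_mult_indicator) auto
      then show "(\<integral>z. indicator (\<Union>i. A i) z *\<^sub>R f z \<partial>?M) = 0"
        using lebesgue_integral_countable_add[of A ?M f] union
        by (auto simp: set_lebesgue_integral_def disjoint_family_on_def)
    qed
  qed
  show ?thesis
    using f ind by (intro circle.density_zero) (auto simp: set_lebesgue_integral_def)
qed

section \<open>The space \<open>L\<^sup>2\<close>\<close>

lift_definition circle_integrable :: "circle_fun \<Rightarrow> bool" is "integrable circle_measure"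
  unfolding ae_eq_def by (intro integrable_cong_AE) auto

text \<open>\<open>Linf\<close> only records that some bound exists, while Schur's algorithm must
  preserve the bound 1 exactly and weak limits must keep the bound C. No sign is imposed on the
  constant.\<close>

lift_definition ess_bound :: "circle_fun \<Rightarrow> real \<Rightarrow> bool"
  is "\<lambda>f C. AE z in circle_measure. cmod (f z) \<le> C"
  by (auto simp: ae_eq_def fun_eq_iff)

text \<open>The value of \<open>z powi n\<close> at 0 is immaterial because the circle carries the
  measure; in the quotient these are the characters, with \<open>zpow_add\<close> valid for all
  integers.\<close>

lift_definition zpow :: "int \<Rightarrow> circle_fun" is "\<lambda>n z. z powi n"
  by (auto simp: ae_eq_def)

lemma zpow_0 [simp]: "zpow 0 = 1"
  by transfer (auto simp: ae_eq_def)

lemma coord_eq_zpow: "coord = zpow 1"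
  by transfer (auto simp: ae_eq_def)

lemma zpow_add: "zpow (m + n) = zpow m * zpow n"
proof (transfer, unfold ae_eq_def, intro conjI)
  show "AE z in circle_measure. z powi (m + n) = z powi m * z powi n" for m n :: int
    using AE_circle_norm
  proof eventually_elim
    case (elim z)
    then have "z \<noteq> 0" by auto
    then show ?case by (simp add: power_int_add)
  qed
qed auto

lemma cnj_powi_unit: "cnj (z powi n) = z powi (- n)" if "cmod z = 1"
proof -
  have "inverse z = cnj z"
    using that divide_conv_cnj[of z 1] by (simp add: field_simps)
  then show ?thesis
    by (simp add: power_int_minus flip: power_int_inverse)
qed

lemma conj_zpow [simp]: "conj_fun (zpow n) = zpow (- n)"
proof (transfer, unfold ae_eq_def, intro conjI)
  show "AE z in circle_measure. cnj (z powi n) = z powi (- n)" for n :: int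
    using AE_circle_norm by eventually_elim (rule cnj_powi_unit)
qed auto

lemma conj_fun_mult [simp]: "conj_fun (f * g) = conj_fun f * conj_fun g"
  by transfer (auto simp: ae_eq_def)

lemma conj_fun_add [simp]: "conj_fun (f + g) = conj_fun f + conj_fun g"
  by transfer (auto simp: ae_eq_def)

lemma conj_fun_diff [simp]: "conj_fun (f - g) = conj_fun f - conj_fun g"
  by transfer (auto simp: ae_eq_def)

lemma conj_fun_cscale [simp]: "conj_fun (cscale c f) = cscale (cnj c) (conj_fun f)"
  by transfer (auto simp: ae_eq_def)

lemma conj_fun_conj [simp]: "conj_fun (conj_fun f) = f"
  by transfer (auto simp: ae_eq_def)

lemma cscale_mult_left [simp]: "cscale c f * g = cscale c (f * g)"
  by transfer (auto simp: ae_eq_def)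

lemma cscale_mult_right [simp]: "f * cscale c g = cscale c (f * g)"
  by transfer (auto simp: ae_eq_def)

lemma cscale_add: "cscale c (f + g) = cscale c f + cscale c g"
  by transfer (auto simp: ae_eq_def algebra_simps)

lemma cscale_cscale [simp]: "cscale c (cscale d f) = cscale (c * d) f"
  by transfer (auto simp: ae_eq_def)

lemma cscale_zero_right [simp]: "cscale c 0 = 0"
  by transfer (auto simp: ae_eq_def)

lemma cscale_zero_left [simp]: "cscale 0 f = 0"
  by transfer (auto simp: ae_eq_def)

lemma cscale_minus_one: "cscale (- 1) f = - f"
  by transfer (auto simp: ae_eq_def)

lemma circle_integral_add:
  "circle_integrable f \<Longrightarrow> circle_integrable g \<Longrightarrow> circle_integral (f + g) = circle_integral f + circle_integral g"
  by transfer auto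

lemma circle_integral_cscale: "circle_integral (cscale c f) = c * circle_integral f"
  by transfer auto

lemma circle_integral_conj: "circle_integral (conj_fun f) = cnj (circle_integral f)"
  by transfer auto

lemma L2_cmult_integrable: "f \<in> L2 \<Longrightarrow> g \<in> L2 \<Longrightarrow> circle_integrable (f * g)"
  unfolding L2_def mem_Collect_eq
proof transfer
  fix f g assume "ae_eq f f" "ae_eq g g"
    and i: "integrable circle_measure (\<lambda>z. (cmod (f z))\<^sup>2)" "integrable circle_measure (\<lambda>z. (cmod (g z))\<^sup>2)"
  then have [measurable]: "f \<in> borel_measurable borel" "g \<in> borel_measurable borel"
    by (auto simp: ae_eq_def)
  have "cmod (f z) * cmod (g z) \<le> (cmod (f z))\<^sup>2 + (cmod (g z))\<^sup>2" for z
    using sum_squares_bound[of "cmod (f z)" "cmod (g z)"] mult_nonneg_nonneg[OF norm_ge_zero norm_ge_zero, of "f z" "g z"]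
    by linarith
  then show "integrable circle_measure (\<lambda>z. f z * g z)"
    by (intro Bochner_Integration.integrable_bound[OF Bochner_Integration.integrable_add[OF i]])
      (auto simp: norm_mult intro!: order_trans[OF _ abs_ge_self])
qed

lemma L2_conj [simp]: "conj_fun f \<in> L2 \<longleftrightarrow> f \<in> L2"
  unfolding L2_def mem_Collect_eq by transfer auto

lemma L2_zero [simp]: "0 \<in> L2"
  unfolding L2_def mem_Collect_eq by transfer auto

lemma L2_cscale: "f \<in> L2 \<Longrightarrow> cscale c f \<in> L2"
  unfolding L2_def mem_Collect_eq by transfer (auto simp: norm_mult power_mult_distrib)

lemma L2_add: "f \<in> L2 \<Longrightarrow> g \<in> L2 \<Longrightarrow> f + g \<in> L2"
  unfolding L2_def mem_Collect_eq
proof transfer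
  fix f g assume "ae_eq f f" "ae_eq g g"
    and i: "integrable circle_measure (\<lambda>z. (cmod (f z))\<^sup>2)" "integrable circle_measure (\<lambda>z. (cmod (g z))\<^sup>2)"
  then have [measurable]: "f \<in> borel_measurable borel" "g \<in> borel_measurable borel"
    by (auto simp: ae_eq_def)
  have "(cmod (f z + g z))\<^sup>2 \<le> 2 * ((cmod (f z))\<^sup>2 + (cmod (g z))\<^sup>2)" for z
    using power_mono[OF norm_triangle_ineq[of "f z" "g z"], of 2] sum_squares_bound[of "cmod (f z)" "cmod (g z)"]
    by (auto simp: power2_sum)
  then show "integrable circle_measure (\<lambda>z. (cmod (f z + g z))\<^sup>2)"
    by (intro Bochner_Integration.integrable_bound[OF integrable_mult_right[OF Bochner_Integration.integrable_add[OF i], of 2]])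
      (auto intro!: order_trans[OF _ abs_ge_self])
qed

lemma L2_uminus: "f \<in> L2 \<Longrightarrow> - f \<in> L2"
  using L2_cscale[of f "-1"] by (simp add: cscale_minus_one)

lemma L2_diff: "f \<in> L2 \<Longrightarrow> g \<in> L2 \<Longrightarrow> f - g \<in> L2"
  using L2_add[OF _ L2_uminus] by fastforce

lemma L2_sum: "(\<And>i. i \<in> A \<Longrightarrow> f i \<in> L2) \<Longrightarrow> sum f A \<in> L2"
  by (induction A rule: infinite_finite_induct) (auto intro: L2_add)

lemma circle_integrable_cinner: "f \<in> L2 \<Longrightarrow> g \<in> L2 \<Longrightarrow> circle_integrable (f * conj_fun g)"
  by (simp add: L2_cmult_integrable)

lemma cinner_add_left: "f \<in> L2 \<Longrightarrow> g \<in> L2 \<Longrightarrow> h \<in> L2 \<Longrightarrow> cinner (f + g) h = cinner f h + cinner g h"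
  by (simp add: cinner_def distrib_right circle_integral_add circle_integrable_cinner)

lemma cinner_cscale_left: "cinner (cscale c f) g = c * cinner f g"
  by (simp add: cinner_def circle_integral_cscale)

lemma cinner_commute: "cinner g f = cnj (cinner f g)"
  by (simp add: cinner_def mult.commute flip: circle_integral_conj)

lemma cinner_cscale_right: "cinner f (cscale c g) = cnj c * cinner f g"
  by (simp add: cinner_def circle_integral_cscale)

lemma cinner_add_right: "f \<in> L2 \<Longrightarrow> g \<in> L2 \<Longrightarrow> h \<in> L2 \<Longrightarrow> cinner f (g + h) = cinner f g + cinner f h"
  by (simp add: cinner_def distrib_left circle_integral_add circle_integrable_cinner)

lemma cinner_zero_left [simp]: "cinner 0 f = 0"
  using cinner_cscale_left[of 0 0] by simp

lemma cinner_zero_right [simp]: "cinner f 0 = 0"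
  using cinner_cscale_right[of f 0 0] by simp

lemma cinner_uminus_left: "cinner (- f) g = - cinner f g"
  using cinner_cscale_left[of "-1"] by (simp add: cscale_minus_one)

lemma cinner_uminus_right: "cinner f (- g) = - cinner f g"
  using cinner_cscale_right[of f "-1"] by (simp add: cscale_minus_one)

lemma cinner_diff_left: "f \<in> L2 \<Longrightarrow> g \<in> L2 \<Longrightarrow> h \<in> L2 \<Longrightarrow> cinner (f - g) h = cinner f h - cinner g h"
  using cinner_add_left[of f "- g" h] by (simp add: L2_uminus cinner_uminus_left)

lemma cinner_diff_right: "f \<in> L2 \<Longrightarrow> g \<in> L2 \<Longrightarrow> h \<in> L2 \<Longrightarrow> cinner f (g - h) = cinner f g - cinner f h"
  using cinner_add_right[of f g "- h"] by (simp add: L2_uminus cinner_uminus_right)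

lemma cinner_sum_left:
  "(\<And>i. i \<in> A \<Longrightarrow> f i \<in> L2) \<Longrightarrow> g \<in> L2 \<Longrightarrow> cinner (sum f A) g = (\<Sum>i\<in>A. cinner (f i) g)"
  by (induction A rule: infinite_finite_induct) (auto simp: cinner_add_left L2_sum)

lemma cinner_sum_right:
  "(\<And>i. i \<in> A \<Longrightarrow> f i \<in> L2) \<Longrightarrow> g \<in> L2 \<Longrightarrow> cinner g (sum f A) = (\<Sum>i\<in>A. cinner g (f i))"
  by (induction A rule: infinite_finite_induct) (auto simp: cinner_add_right L2_sum)

lemma cinner_mult_left: "cinner (u * f) g = cinner f (conj_fun u * g)"
  by (simp add: cinner_def mult_ac)

text \<open>No integrability is assumed: \<open>f * conj_fun f\<close> is a nonnegative real
  function, and a divergent Bochner integral has the default value 0.\<close>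

lemma cinner_self_nonneg: "0 \<le> Re (cinner f f)" "Im (cinner f f) = 0"
proof -
  have "\<exists>r\<ge>0. cinner f f = complex_of_real r"
    unfolding cinner_def
  proof transfer
    fix f :: "complex \<Rightarrow> complex"
    show "\<exists>r\<ge>0. (\<integral>z. f z * cnj (f z) \<partial>circle_measure) = complex_of_real r"
      by (rule exI[of _ "\<integral>z. (cmod (f z))\<^sup>2 \<partial>circle_measure"])
        (simp add: complex_norm_square[symmetric] del: of_real_power)
  qed
  then show "0 \<le> Re (cinner f f)" "Im (cinner f f) = 0"
    by auto
qed

lemma L2_norm_nonneg [simp]: "0 \<le> L2_norm f"
  by (simp add: L2_norm_def cinner_self_nonneg)

lemma cinner_self: "cinner f f = complex_of_real ((L2_norm f)\<^sup>2)"
  by (simp add: L2_norm_def cinner_self_nonneg complex_eq_iff)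

lemma L2_norm_eq_0: "f = 0" if "f \<in> L2" "L2_norm f = 0"
proof -
  from that have "f \<in> L2" "circle_integral (f * conj_fun f) = 0"
    using cinner_self[of f] by (simp_all add: cinner_def)
  then show ?thesis
    unfolding L2_def mem_Collect_eq
  proof transfer
    fix f assume "ae_eq f f" and i: "integrable circle_measure (\<lambda>z. (cmod (f z))\<^sup>2)"
      and 0: "(\<integral>z. f z * cnj (f z) \<partial>circle_measure) = 0"
    then have [measurable]: "f \<in> borel_measurable borel"
      by (auto simp: ae_eq_def)
    have "(\<integral>z. complex_of_real ((cmod (f z))\<^sup>2) \<partial>circle_measure) = 0"
      using 0 by (simp only: complex_norm_square)
    then have "(\<integral>z. (cmod (f z))\<^sup>2 \<partial>circle_measure) = 0"
      by (simp only: integral_complex_of_real of_real_eq_0_iff)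
    then show "ae_eq f (\<lambda>_. 0)"
      using i by (subst (asm) integral_nonneg_eq_0_iff_AE) (auto simp: ae_eq_def)
  qed
qed

lemma L2_norm_diff_commute: "L2_norm (f - g) = L2_norm (g - f)"
  by (simp add: L2_norm_def cinner_def algebra_simps)

lemma cinner_Cauchy_Schwarz:
  assumes "f \<in> L2" "g \<in> L2"
  shows "cmod (cinner f g) \<le> L2_norm f * L2_norm g"
proof (cases "L2_norm g = 0")
  case True
  then show ?thesis using L2_norm_eq_0[OF assms(2)] by simp
next
  case False
  define t where "t = cinner f g"
  define r where "r = complex_of_real ((L2_norm g)\<^sup>2)"
  have r: "r \<noteq> 0" "cnj r = r" using False by (auto simp: r_def)
  \<comment> \<open>The component of \<open>f\<close> orthogonal to \<open>g\<close>; its squared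
    norm is the defect in the inequality, divided by the squared norm of \<open>g\<close>.\<close>
  let ?h = "f - cscale (t / r) g"
  have "cinner ?h ?h = cinner f f - (cnj t / r) * t - (t / r) * cnj t + (t / r) * ((cnj t / r) * r)"
    using assms r cinner_commute[of g f]
    by (simp add: cinner_diff_left cinner_diff_right L2_diff L2_cscale cinner_cscale_left
      cinner_cscale_right cinner_self[of g, folded r_def] t_def[symmetric])
  also have "\<dots> = cinner f f - t * cnj t / r"
    using r by (simp add: field_simps)
  also have "\<dots> = complex_of_real ((L2_norm f)\<^sup>2 - (cmod t)\<^sup>2 / (L2_norm g)\<^sup>2)"
    by (simp add: cinner_self r_def flip: complex_norm_square)
  finally have "0 \<le> (L2_norm f)\<^sup>2 - (cmod t)\<^sup>2 / (L2_norm g)\<^sup>2"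
    using cinner_self_nonneg(1)[of ?h] by simp
  then have "(cmod t)\<^sup>2 \<le> (L2_norm f * L2_norm g)\<^sup>2"
    using False by (simp add: field_simps power_mult_distrib)
  then show ?thesis
    unfolding t_def by (rule power2_le_imp_le) simp
qed

lemma L2_norm_triangle:
  assumes "f \<in> L2" "g \<in> L2"
  shows "L2_norm (f + g) \<le> L2_norm f + L2_norm g"
proof (rule power2_le_imp_le)
  have "complex_of_real ((L2_norm (f + g))\<^sup>2) = 
      complex_of_real ((L2_norm f)\<^sup>2) + complex_of_real ((L2_norm g)\<^sup>2) + (cinner f g + cnj (cinner f g))"
    using assms cinner_commute[of g f]
    by (simp add: cinner_add_left cinner_add_right L2_add del: of_real_power flip: cinner_self)
  then have "complex_of_real ((L2_norm (f + g))\<^sup>2) = 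
      complex_of_real ((L2_norm f)\<^sup>2 + (L2_norm g)\<^sup>2 + 2 * Re (cinner f g))"
    by (simp add: complex_add_cnj)
  then have "(L2_norm (f + g))\<^sup>2 = (L2_norm f)\<^sup>2 + (L2_norm g)\<^sup>2 + 2 * Re (cinner f g)"
    by (simp only: of_real_eq_iff)
  also have "Re (cinner f g) \<le> L2_norm f * L2_norm g"
    using cinner_Cauchy_Schwarz[OF assms] complex_Re_le_cmod order_trans by blast
  finally show "(L2_norm (f + g))\<^sup>2 \<le> (L2_norm f + L2_norm g)\<^sup>2"
    by (simp add: power2_sum)
qed simp

lemma L2_norm_triangle_diff:
  "f \<in> L2 \<Longrightarrow> g \<in> L2 \<Longrightarrow> h \<in> L2 \<Longrightarrow> L2_norm (f - h) \<le> L2_norm (f - g) + L2_norm (g - h)"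
  using L2_norm_triangle[of "f - g" "g - h"] by (simp add: L2_diff)

lemma Linf_iff_ess_bound: "f \<in> Linf \<longleftrightarrow> (\<exists>C\<ge>0. ess_bound f C)"
proof -
  have "f \<in> Linf \<longleftrightarrow> (\<exists>C. ess_bound f C)"
    unfolding Linf_def mem_Collect_eq by transfer auto
  moreover have "ess_bound f C \<Longrightarrow> ess_bound f (max 0 C)" for C
    by transfer (auto elim!: eventually_mono)
  ultimately show ?thesis by (meson max.cobounded1)
qed

lemma ess_bound_L2_mult:
  assumes "ess_bound u C" "f \<in> L2" "0 \<le> C"
  shows "u * f \<in> L2" and "L2_norm (u * f) \<le> C * L2_norm f"
proof -
  have 1: "u * f \<in> L2 \<and> Re (circle_integral ((u * f) * conj_fun (u * f))) \<le> C\<^sup>2 * Re (circle_integral (f * conj_fun f))"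
    using assms(1,2) unfolding L2_def mem_Collect_eq
  proof transfer
    fix u C f assume "ae_eq u u" "ae_eq f f" 
      and u: "AE z in circle_measure. cmod (u z) \<le> C"
      and f: "integrable circle_measure (\<lambda>z. (cmod (f z))\<^sup>2)"
    then have [measurable]: "f \<in> borel_measurable borel" "u \<in> borel_measurable borel"
      by (auto simp: ae_eq_def)
    have le: "AE z in circle_measure. (cmod (u z * f z))\<^sup>2 \<le> C\<^sup>2 * (cmod (f z))\<^sup>2"
      using u by eventually_elim (auto simp: norm_mult power_mult_distrib intro!: mult_right_mono power_mono)
    have i: "integrable circle_measure (\<lambda>z. (cmod (u z * f z))\<^sup>2)"
      by (rule Bochner_Integration.integrable_bound[of _ "\<lambda>z. C\<^sup>2 * (cmod (f z))\<^sup>2"])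
        (use f le in auto)
    have int_le: "(\<integral>z. (cmod (u z * f z))\<^sup>2 \<partial>circle_measure) \<le> (\<integral>z. C\<^sup>2 * (cmod (f z))\<^sup>2 \<partial>circle_measure)"
      using i f le by (intro integral_mono_AE) auto
    have Re_eq: "Re (\<integral>z. g z * cnj (g z) \<partial>circle_measure) = (\<integral>z. (cmod (g z))\<^sup>2 \<partial>circle_measure)" for g
      by (simp add: complex_norm_square[symmetric] del: of_real_power)
    show "integrable circle_measure (\<lambda>z. (cmod (u z * f z))\<^sup>2) \<and>
      Re (\<integral>z. u z * f z * cnj (u z * f z) \<partial>circle_measure) \<le> C\<^sup>2 * Re (\<integral>z. f z * cnj (f z) \<partial>circle_measure)"
      using i int_le Re_eq[of "\<lambda>z. u z * f z"] Re_eq[of f] by simp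
  qed
  then show "u * f \<in> L2" by simp
  show "L2_norm (u * f) \<le> C * L2_norm f"
    using 1 \<open>0 \<le> C\<close> unfolding L2_norm_def cinner_def
    by (metis real_sqrt_le_mono real_sqrt_mult real_sqrt_abs abs_of_nonneg)
qed

lemma ess_bound_mult: "ess_bound f C \<Longrightarrow> ess_bound g D \<Longrightarrow> 0 \<le> C \<Longrightarrow> ess_bound (f * g) (C * D)"
proof transfer
  fix f g :: "complex \<Rightarrow> complex" and C D :: real
  assume "AE z in circle_measure. cmod (f z) \<le> C" "AE z in circle_measure. cmod (g z) \<le> D" "0 \<le> C"
  then show "AE z in circle_measure. cmod (f z * g z) \<le> C * D"
    by (auto simp: norm_mult elim!: eventually_elim2 intro!: mult_mono)
qed

lemma ess_bound_add: "ess_bound f C \<Longrightarrow> ess_bound g D \<Longrightarrow> ess_bound (f + g) (C + D)"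
proof transfer
  fix f g :: "complex \<Rightarrow> complex" and C D :: real
  assume "AE z in circle_measure. cmod (f z) \<le> C" "AE z in circle_measure. cmod (g z) \<le> D"
  then show "AE z in circle_measure. cmod (f z + g z) \<le> C + D"
    by (auto elim!: eventually_elim2 intro!: norm_triangle_mono)
qed

lemma ess_bound_cscale: "ess_bound f C \<Longrightarrow> ess_bound (cscale c f) (cmod c * C)"
  by transfer (auto simp: norm_mult mult_left_mono elim!: eventually_mono)

lemma ess_bound_conj [simp]: "ess_bound (conj_fun f) C \<longleftrightarrow> ess_bound f C"
  by transfer auto

lemma ess_bound_zpow: "ess_bound (zpow n) 1"
  by transfer (auto simp: norm_power_int intro: eventually_mono[OF AE_circle_norm])

lemma unimodular_ess_bound: "unimodular u \<Longrightarrow> ess_bound u 1"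
  by transfer (auto elim!: eventually_mono)

lemma unimodular_mult_conj: "unimodular u \<Longrightarrow> u * conj_fun u = 1"
  by transfer (auto simp: ae_eq_def simp flip: complex_norm_square elim!: eventually_mono)

lemma unimodular_L2_norm:
  assumes "unimodular u" shows "L2_norm (u * f) = L2_norm f"
proof -
  have "u * f * conj_fun (u * f) = (u * conj_fun u) * (f * conj_fun f)"
    by (simp add: mult_ac)
  then show ?thesis
    by (simp add: L2_norm_def cinner_def unimodular_mult_conj[OF assms])
qed

lemma L2_one [simp]: "1 \<in> L2"
  unfolding L2_def mem_Collect_eq by transfer simp

lemma L2_zpow [simp]: "zpow n \<in> L2"
  using ess_bound_L2_mult(1)[OF ess_bound_zpow L2_one, of n] by simp

lemma cinner_zpow_zpow: "cinner (zpow m) (zpow n) = (if m = n then 1 else 0)"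
proof -
  have "cinner (zpow m) (zpow n) = circle_integral (zpow (m - n))"
    by (simp add: cinner_def flip: zpow_add)
  also have "\<dots> = (if m - n = 0 then 1 else 0)"
    by transfer (rule integral_circle_powi)
  finally show ?thesis by simp
qed

lemma fourier_coeff_eq_cinner: "fourier_coeff f n = cinner f (zpow n)"
  unfolding cinner_def conj_zpow by transfer simp

lemma fourier_coeff_unique:
  assumes "f \<in> L2" "g \<in> L2" "\<And>n. fourier_coeff f n = fourier_coeff g n"
  shows "f = g"
proof -
  have "circle_integrable (f - g)"
    using L2_cmult_integrable[of "f - g" 1] assms by (simp add: L2_diff)
  moreover have "\<And>n. circle_integral ((f - g) * zpow n) = 0"
  proof -
    fix n
    have "circle_integral ((f - g) * zpow n) = cinner (f - g) (zpow (- n))"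
      by (simp add: cinner_def)
    also have "\<dots> = 0"
      using assms by (simp add: cinner_diff_left fourier_coeff_eq_cinner)
    finally show "circle_integral ((f - g) * zpow n) = 0" .
  qed
  ultimately have "f - g = 0"
  proof transfer
    fix f g assume "ae_eq f f" "ae_eq g g" "integrable circle_measure (\<lambda>z. f z - g z)"
      "\<And>n. (\<integral>z. (f z - g z) * z powi n \<partial>circle_measure) = 0"
    then show "ae_eq (\<lambda>z. f z - g z) (\<lambda>_. 0)"
      using trig_unique[of "\<lambda>z. f z - g z"] by (auto simp: ae_eq_def)
  qed
  then show ?thesis by simp
qed

section \<open>Completeness and Fourier series\<close>

text \<open>\<open>L2\<close> is a mere subset of a quotient type, so completeness is proved on
  representatives: a fast subsequence has summable increments in the mean, hence converges almost
  everywhere, and Fatou's lemma upgrades this to convergence of the whole sequence in the square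
  mean.\<close>

lemma L2_fun_complete:
  fixes q :: "nat \<Rightarrow> complex \<Rightarrow> complex"
  assumes [measurable]: "\<And>n. q n \<in> borel_measurable borel"
    and int: "\<And>n. integrable circle_measure (\<lambda>z. (cmod (q n z))\<^sup>2)"
    and Cauchy: "\<And>e. e > 0 \<Longrightarrow> \<exists>N. \<forall>m\<ge>N. \<forall>n\<ge>N. (\<integral>z. (cmod (q m z - q n z))\<^sup>2 \<partial>circle_measure) < e"
  shows "\<exists>F. F \<in> borel_measurable borel \<and> integrable circle_measure (\<lambda>z. (cmod (F z))\<^sup>2) \<and>
    (\<lambda>n. \<integral>z. (cmod (q n z - F z))\<^sup>2 \<partial>circle_measure) \<longlonglongrightarrow> 0"
proof -
  let ?M = circle_measure
  have sq_diff: "(cmod (a - b))\<^sup>2 \<le> 2 * ((cmod a)\<^sup>2 + (cmod b)\<^sup>2)" for a b :: complex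
    using power_mono[OF norm_triangle_ineq4[of a b], of 2] sum_squares_bound[of "cmod a" "cmod b"]
    by (auto simp: power2_sum)
  have int_diff: "integrable ?M (\<lambda>z. (cmod (f z - g z))\<^sup>2)"
    if "integrable ?M (\<lambda>z. (cmod (f z))\<^sup>2)" "integrable ?M (\<lambda>z. (cmod (g z))\<^sup>2)"
      and [measurable]: "f \<in> borel_measurable borel" "g \<in> borel_measurable borel" for f g
    by (rule Bochner_Integration.integrable_bound[OF integrable_mult_right[OF Bochner_Integration.integrable_add[OF that(1,2)], of 2]])
      (use sq_diff in \<open>auto intro!: AE_I2 order_trans[OF _ abs_ge_self]\<close>)
  \<comment> \<open>The bound is on squared distances, so increments of the subsequence have norm at
    most 2^-k.\<close>
  define P where "P k N \<longleftrightarrow> (\<forall>m\<ge>N. \<forall>n\<ge>N. (\<integral>z. (cmod (q m z - q n z))\<^sup>2 \<partial>?M) < (1/4)^k)" for k :: nat and N :: nat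
  have ex: "\<exists>N. P k N" for k
    unfolding P_def by (rule Cauchy) simp
  have P_mono: "P k N \<Longrightarrow> N \<le> N' \<Longrightarrow> P k N'" for k N N'
    unfolding P_def by (meson order_trans)
  have "\<exists>r. \<forall>k. P k (r k) \<and> r k < r (Suc k)"
  proof (rule dependent_nat_choice)
    fix x k assume "P k x"
    obtain N where "P (Suc k) N" using ex by blast
    then show "\<exists>y. P (Suc k) y \<and> x < y"
      by (intro exI[of _ "max N (Suc x)"]) (auto intro: P_mono)
  qed (use ex in auto)
  then obtain r where r: "\<And>k. P k (r k)" "\<And>k. r k < r (Suc k)" by blast
  have mono: "strict_mono r" using r(2) by (simp add: strict_mono_Suc_iff)
  have small: "(\<integral>z. (cmod (q n z - q (r j) z))\<^sup>2 \<partial>?M) \<le> (1/4)^k" if "n \<ge> r k" "j \<ge> k" for n j k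
    using r(1)[of k] that monoD[OF strict_mono_mono[OF mono] that(2)] unfolding P_def by (auto intro: less_imp_le)
  define D where "D k z = q (r (Suc k)) z - q (r k) z" for k z
  have [measurable]: "D k \<in> borel_measurable borel" for k unfolding D_def by measurable
  have iD: "integrable ?M (\<lambda>z. (cmod (D k z))\<^sup>2)" for k
    unfolding D_def by (rule int_diff[OF int int]) auto
  have nD: "(\<integral>\<^sup>+z. ennreal (cmod (D k z)) \<partial>?M) \<le> ennreal ((1/2)^k)" for k
  proof -
    \<comment> \<open>The arithmetic-geometric inequality with weights 2^-k and 2^k. As the measure
      has mass 1, it converts the squared bound 4^-k into the mean bound 2^-k.\<close>
    have le: "cmod (D k z) \<le> ((1/2)^k + 2^k * (cmod (D k z))\<^sup>2) / 2" for z
    proof -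
      have "0 \<le> (1/2)^k * (1 - 2^k * cmod (D k z))\<^sup>2" by simp
      also have "\<dots> = (1/2)^k - 2 * ((1/2)^k * 2^k) * cmod (D k z) + ((1/2)^k * 2^k) * 2^k * (cmod (D k z))\<^sup>2"
        by (simp add: power2_eq_square algebra_simps)
      also have "(1/2::real)^k * 2^k = 1" by (simp flip: power_mult_distrib)
      finally show ?thesis by simp
    qed
    have i: "integrable ?M (\<lambda>z. ((1/2)^k + 2^k * (cmod (D k z))\<^sup>2) / 2)"
      using iD[of k] by auto
    have "(\<integral>\<^sup>+z. ennreal (cmod (D k z)) \<partial>?M) \<le> (\<integral>\<^sup>+z. ennreal (((1/2)^k + 2^k * (cmod (D k z))\<^sup>2) / 2) \<partial>?M)"
      by (intro nn_integral_mono ennreal_leI le)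
    also have "\<dots> = ennreal (\<integral>z. ((1/2)^k + 2^k * (cmod (D k z))\<^sup>2) / 2 \<partial>?M)"
      using i by (intro nn_integral_eq_integral) auto
    also have "(\<integral>z. ((1/2)^k + 2^k * (cmod (D k z))\<^sup>2) / 2 \<partial>?M) = ((1/2)^k + 2^k * (\<integral>z. (cmod (D k z))\<^sup>2 \<partial>?M)) / 2"
      using iD[of k] by (simp add: measure_circle_UNIV)
    also have "\<dots> \<le> ((1/2)^k + 2^k * (1/4)^k) / 2"
    proof -
      have "(\<integral>z. (cmod (D k z))\<^sup>2 \<partial>?M) \<le> (1/4)^k"
        using small[of k "r (Suc k)" k] r(2)[of k] by (simp add: D_def)
      then show ?thesis by simp
    qed
    also have "\<dots> = (1/2)^k" by (simp flip: power_mult_distrib)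
    finally show ?thesis by (simp add: ennreal_leI)
  qed
  have "(\<integral>\<^sup>+z. (\<Sum>k. ennreal (cmod (D k z))) \<partial>?M) = (\<Sum>k. \<integral>\<^sup>+z. ennreal (cmod (D k z)) \<partial>?M)"
    by (rule nn_integral_suminf) auto
  also have "\<dots> \<le> (\<Sum>k. ennreal ((1/2)^k))"
    by (intro suminf_le nD) auto
  also have "\<dots> = ennreal (\<Sum>k. (1/2)^k)"
    by (intro suminf_ennreal2) auto
  finally have "(\<integral>\<^sup>+z. (\<Sum>k. ennreal (cmod (D k z))) \<partial>?M) \<noteq> \<infinity>"
    by (auto simp: top_unique)
  then have "AE z in ?M. (\<Sum>k. ennreal (cmod (D k z))) \<noteq> \<infinity>"
    by (intro nn_integral_PInf_AE) auto
  then have conv: "AE z in ?M. convergent (\<lambda>k. q (r k) z)"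
  proof eventually_elim
    case (elim z)
    have "summable (\<lambda>k. cmod (D k z))"
      using elim by (intro summable_suminf_not_top) auto
    then have "summable (\<lambda>k. D k z)" by (rule summable_norm_cancel)
    then have "convergent (\<lambda>n. q (r 0) z + (\<Sum>k<n. D k z))"
      by (intro convergent_add convergent_const) (simp add: summable_iff_convergent)
    moreover have "q (r 0) z + (\<Sum>k<n. D k z) = q (r n) z" for n
      unfolding D_def by (subst sum_lessThan_telescope) simp
    ultimately show ?case by simp
  qed
  define F where "F z = lim (\<lambda>k. q (r k) z)" for z
  have [measurable]: "F \<in> borel_measurable borel"
    unfolding F_def by measurable
  have lim: "AE z in ?M. (\<lambda>k. q (r k) z) \<longlonglongrightarrow> F z"
    using conv by eventually_elim (simp add: F_def convergent_LIMSEQ_iff)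
  \<comment> \<open>One estimate serves twice: finiteness gives square integrability of the
    difference, smallness gives the convergence.\<close>
  have fatou: "(\<integral>\<^sup>+z. ennreal ((cmod (q n z - F z))\<^sup>2) \<partial>?M) \<le> ennreal ((1/4)^k)" if "n \<ge> r k" for n k
  proof -
    have "(\<integral>\<^sup>+z. ennreal ((cmod (q n z - F z))\<^sup>2) \<partial>?M) =
      (\<integral>\<^sup>+z. liminf (\<lambda>j. ennreal ((cmod (q n z - q (r j) z))\<^sup>2)) \<partial>?M)"
    proof (rule nn_integral_cong_AE)
      show "AE z in ?M. ennreal ((cmod (q n z - F z))\<^sup>2) = liminf (\<lambda>j. ennreal ((cmod (q n z - q (r j) z))\<^sup>2))"
        using lim
      proof eventually_elim
        case (elim z)
        then have "(\<lambda>j. ennreal ((cmod (q n z - q (r j) z))\<^sup>2)) \<longlonglongrightarrow> ennreal ((cmod (q n z - F z))\<^sup>2)"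
          by (intro tendsto_intros tendsto_ennrealI)
        then show ?case by (intro lim_imp_Liminf[symmetric]) auto
      qed
    qed
    also have "\<dots> \<le> liminf (\<lambda>j. \<integral>\<^sup>+z. ennreal ((cmod (q n z - q (r j) z))\<^sup>2) \<partial>?M)"
      by (rule nn_integral_liminf) auto
    also have "\<dots> \<le> liminf (\<lambda>j. ennreal ((1/4)^k))"
    proof (intro Liminf_mono eventually_sequentiallyI[of k])
      fix j assume "j \<ge> k"
      have "(\<integral>\<^sup>+z. ennreal ((cmod (q n z - q (r j) z))\<^sup>2) \<partial>?M) = ennreal (\<integral>z. (cmod (q n z - q (r j) z))\<^sup>2 \<partial>?M)"
        by (intro nn_integral_eq_integral int_diff int) auto
      then show "(\<integral>\<^sup>+z. ennreal ((cmod (q n z - q (r j) z))\<^sup>2) \<partial>?M) \<le> ennreal ((1/4)^k)"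
        using small[OF that \<open>j \<ge> k\<close>] by (simp add: ennreal_leI)
    qed
    finally show ?thesis by (simp add: Liminf_const)
  qed
  have i: "integrable ?M (\<lambda>z. (cmod (q n z - F z))\<^sup>2)" and b: "(\<integral>z. (cmod (q n z - F z))\<^sup>2 \<partial>?M) \<le> (1/4)^k" 
    if "n \<ge> r k" for n k
  proof -
    show i: "integrable ?M (\<lambda>z. (cmod (q n z - F z))\<^sup>2)"
      using fatou[OF that] by (intro integrableI_bounded) (auto simp: le_less_trans[OF _ ennreal_less_top])
    show "(\<integral>z. (cmod (q n z - F z))\<^sup>2 \<partial>?M) \<le> (1/4)^k"
      using fatou[OF that] nn_integral_eq_integral[OF i] by simp
  qed
  \<comment> \<open>\<open>F\<close> is written as \<open>q (r 0)\<close> minus the square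
    integrable difference \<open>q (r 0) - F\<close>.\<close>
  have "integrable ?M (\<lambda>z. (cmod (q (r 0) z - (q (r 0) z - F z)))\<^sup>2)"
    by (rule int_diff[OF int i[OF order_refl]]) auto
  moreover have "(\<lambda>n. \<integral>z. (cmod (q n z - F z))\<^sup>2 \<partial>?M) \<longlonglongrightarrow> 0"
  proof (rule LIMSEQ_I)
    fix e :: real assume "e > 0"
    then obtain k where k: "(1/4)^k < e" using real_arch_pow_inv[of e "1/4"] by auto
    have "norm ((\<integral>z. (cmod (q n z - F z))\<^sup>2 \<partial>?M) - 0) < e" if "n \<ge> r k" for n
      using b[OF that] k by simp
    then show "\<exists>no. \<forall>n\<ge>no. norm ((\<integral>z. (cmod (q n z - F z))\<^sup>2 \<partial>?M) - 0) < e" by blast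
  qed
  ultimately show ?thesis by (intro exI[of _ F]) simp
qed

lift_definition sq_integral :: "circle_fun \<Rightarrow> real" is "\<lambda>f. \<integral>z. (cmod (f z))\<^sup>2 \<partial>circle_measure"
  unfolding ae_eq_def by (intro integral_cong_AE) auto

lemma L2_norm_power2: "(L2_norm f)\<^sup>2 = sq_integral f"
proof -
  have "Re (circle_integral (f * conj_fun f)) = sq_integral f"
    by transfer (simp add: complex_norm_square[symmetric] del: of_real_power)
  then show ?thesis
    using cinner_self_nonneg(1)[of f] by (simp add: L2_norm_def cinner_def)
qed

lemma L2_complete:
  assumes "\<And>n. p n \<in> L2"
    and "\<And>e. e > 0 \<Longrightarrow> \<exists>N. \<forall>m\<ge>N. \<forall>n\<ge>N. L2_norm (p m - p n) < e"
  shows "\<exists>F\<in>L2. (\<lambda>n. L2_norm (p n - F)) \<longlonglongrightarrow> 0"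
proof -
  have C: "\<exists>N. \<forall>m\<ge>N. \<forall>n\<ge>N. sq_integral (p m - p n) < e" if "e > 0" for e
  proof -
    have "sqrt e > 0" using that by simp
    from assms(2)[OF this] obtain N where "\<forall>m\<ge>N. \<forall>n\<ge>N. L2_norm (p m - p n) < sqrt e"
      by blast
    then have "\<And>m n. m\<ge>N \<Longrightarrow> n\<ge>N \<Longrightarrow> (L2_norm (p m - p n))\<^sup>2 < (sqrt e)\<^sup>2"
      by (intro power_strict_mono) auto
    then show ?thesis using that by (auto simp flip: L2_norm_power2)
  qed
  have I: "\<And>n. square_integrable (p n)" using assms by (simp add: L2_def)
  have "\<exists>F. square_integrable F \<and> (\<lambda>n. sq_integral (p n - F)) \<longlonglongrightarrow> 0"
    using I C
  proof transfer
    fix p :: "nat \<Rightarrow> complex \<Rightarrow> complex"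
    assume *: "pred_fun top (\<lambda>x. ae_eq x x) p" "\<And>n. integrable circle_measure (\<lambda>z. (cmod (p n z))\<^sup>2)"
      "\<And>e. 0 < e \<Longrightarrow> \<exists>N. \<forall>m\<ge>N. \<forall>n\<ge>N. (LINT z|circle_measure. (cmod (p m z - p n z))\<^sup>2) < e"
    then have "\<And>n. ae_eq (p n) (p n)" by simp
    then have meas: "p n \<in> borel_measurable borel" for n
    proof -
      have "p n \<in> borel_measurable circle_measure"
        using \<open>\<And>n. ae_eq (p n) (p n)\<close> unfolding ae_eq_def by blast
      then show ?thesis by measurable
    qed
    have "\<exists>F. F \<in> borel_measurable borel \<and> integrable circle_measure (\<lambda>z. (cmod (F z))\<^sup>2) \<and>
        (\<lambda>n. \<integral>z. (cmod (p n z - F z))\<^sup>2 \<partial>circle_measure) \<longlonglongrightarrow> 0"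
    proof (rule L2_fun_complete[of p])
      show "\<And>n. p n \<in> borel_measurable borel" by (rule meas)
      show "\<And>n. integrable circle_measure (\<lambda>z. (cmod (p n z))\<^sup>2)" by (rule *(2))
      show "\<exists>N. \<forall>m\<ge>N. \<forall>n\<ge>N. (\<integral>z. (cmod (p m z - p n z))\<^sup>2 \<partial>circle_measure) < e" if "e > 0" for e
        using that by (rule *(3))
    qed
    then obtain F where F: "F \<in> borel_measurable borel"
      "integrable circle_measure (\<lambda>z. (cmod (F z))\<^sup>2)"
      "(\<lambda>n. \<integral>z. (cmod (p n z - F z))\<^sup>2 \<partial>circle_measure) \<longlonglongrightarrow> 0"
      by (elim exE conjE)
    have "F \<in> {x. ae_eq x x}" using F(1) by (simp add: ae_eq_def)
    then show "\<exists>F\<in>{x. ae_eq x x}. integrable circle_measure (\<lambda>z. (cmod (F z))\<^sup>2) \<and>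
            (\<lambda>n. LINT z|circle_measure. (cmod (p n z - F z))\<^sup>2) \<longlonglongrightarrow> 0"
      using F(2,3) by (intro bexI[of _ F] conjI)
  qed
  then obtain F where F: "F \<in> L2" "(\<lambda>n. (L2_norm (p n - F))\<^sup>2) \<longlonglongrightarrow> 0"
    unfolding L2_norm_power2 L2_def by blast
  show ?thesis
    using F(1) tendsto_real_sqrt[OF F(2)] by (intro bexI[of _ F]) simp_all
qed

section \<open>Trigonometric polynomials, the Riesz-Fischer theorem and Parseval's identity\<close>

definition trig_poly :: "(int \<Rightarrow> complex) \<Rightarrow> int set \<Rightarrow> circle_fun" where
  "trig_poly c A = (\<Sum>n\<in>A. cscale (c n) (zpow n))"

lemma trig_poly_L2 [simp]: "trig_poly c A \<in> L2"
  by (simp add: trig_poly_def L2_sum L2_cscale)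

lemma cinner_trig_poly_right:
  "f \<in> L2 \<Longrightarrow> cinner f (trig_poly c A) = (\<Sum>n\<in>A. fourier_coeff f n * cnj (c n))"
  by (simp add: trig_poly_def cinner_sum_right L2_cscale cinner_cscale_right fourier_coeff_eq_cinner mult.commute)

lemma fourier_coeff_trig_poly:
  "finite A \<Longrightarrow> fourier_coeff (trig_poly c A) n = (if n \<in> A then c n else 0)"
  by (simp add: trig_poly_def fourier_coeff_eq_cinner cinner_sum_left L2_cscale cinner_cscale_left
      cinner_zpow_zpow if_distrib sum.delta cong: if_cong)

lemma L2_norm_trig_poly: "finite A \<Longrightarrow> (L2_norm (trig_poly c A))\<^sup>2 = (\<Sum>n\<in>A. (cmod (c n))\<^sup>2)"
proof -
  assume "finite A"
  then have "complex_of_real ((L2_norm (trig_poly c A))\<^sup>2) = complex_of_real (\<Sum>n\<in>A. (cmod (c n))\<^sup>2)"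
    by (simp add: cinner_trig_poly_right fourier_coeff_trig_poly complex_norm_square del: of_real_power flip: cinner_self)
  then show ?thesis by (simp only: of_real_eq_iff)
qed

lemma fourier_coeff_add: "f \<in> L2 \<Longrightarrow> g \<in> L2 \<Longrightarrow> fourier_coeff (f + g) n = fourier_coeff f n + fourier_coeff g n"
  by (simp add: fourier_coeff_eq_cinner cinner_add_left)

lemma fourier_coeff_diff: "f \<in> L2 \<Longrightarrow> g \<in> L2 \<Longrightarrow> fourier_coeff (f - g) n = fourier_coeff f n - fourier_coeff g n"
  by (simp add: fourier_coeff_eq_cinner cinner_diff_left)

lemma fourier_coeff_cscale: "fourier_coeff (cscale c f) n = c * fourier_coeff f n"
  by (simp add: fourier_coeff_eq_cinner cinner_cscale_left)

lemma fourier_coeff_conj: "fourier_coeff (conj_fun f) n = cnj (fourier_coeff f (- n))"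
  by (simp add: fourier_coeff_eq_cinner cinner_def mult.commute flip: circle_integral_conj)

lemma fourier_coeff_zpow_mult: "fourier_coeff (zpow m * f) n = fourier_coeff f (n - m)"
  by (simp add: fourier_coeff_eq_cinner cinner_mult_left flip: zpow_add)

lemma L2_norm_zpow [simp]: "L2_norm (zpow n) = 1"
  by (simp add: L2_norm_def cinner_zpow_zpow)

lemma fourier_coeff_bound: "f \<in> L2 \<Longrightarrow> cmod (fourier_coeff f n) \<le> L2_norm f"
  using cinner_Cauchy_Schwarz[of f "zpow n"] by (simp add: fourier_coeff_eq_cinner)

lemma fourier_coeff_tendsto:
  assumes "\<And>k. p k \<in> L2" "f \<in> L2" "(\<lambda>k. L2_norm (p k - f)) \<longlonglongrightarrow> 0"
  shows "(\<lambda>k. fourier_coeff (p k) n) \<longlonglongrightarrow> fourier_coeff f n"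
proof (rule LIM_zero_cancel, rule Lim_null_comparison[OF _ assms(3)])
  show "\<forall>\<^sub>F k in sequentially. norm (fourier_coeff (p k) n - fourier_coeff f n) \<le> L2_norm (p k - f)"
    using assms(1,2) fourier_coeff_bound[of "p _ - f" n] by (simp add: L2_diff fourier_coeff_diff)
qed

lemma cinner_tendsto_left:
  assumes "\<And>k. p k \<in> L2" "f \<in> L2" "g \<in> L2" "(\<lambda>k. L2_norm (p k - f)) \<longlonglongrightarrow> 0"
  shows "(\<lambda>k. cinner (p k) g) \<longlonglongrightarrow> cinner f g"
proof (rule LIM_zero_cancel, rule Lim_null_comparison)
  show "\<forall>\<^sub>F k in sequentially. norm (cinner (p k) g - cinner f g) \<le> L2_norm (p k - f) * L2_norm g"
    using assms cinner_Cauchy_Schwarz[of "p _ - f" g] by (simp add: L2_diff cinner_diff_left)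
qed (use tendsto_mult_right[OF assms(4)] in simp)

lemma trig_poly_diff: "finite A \<Longrightarrow> B \<subseteq> A \<Longrightarrow> trig_poly c A - trig_poly c B = trig_poly c (A - B)"
  by (simp add: trig_poly_def sum_diff)

text \<open>Orthonormality turns squared distances of symmetric partial sums into differences of a
  bounded increasing sequence, so the partial sums are Cauchy. This is the source of the functions
  built later from coefficients: analytic parts and weak limits.\<close>

theorem Riesz_Fischer:
  assumes "\<And>M. (\<Sum>n\<in>{- int M..int M}. (cmod (c n))\<^sup>2) \<le> B"
  shows "\<exists>F\<in>L2. (\<forall>n. fourier_coeff F n = c n) \<and> 
    (\<lambda>M. L2_norm (trig_poly c {- int M..int M} - F)) \<longlonglongrightarrow> 0"
proof -
  define s where "s M = (\<Sum>n\<in>{- int M..int M}. (cmod (c n))\<^sup>2)" for M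
  define p where "p M = trig_poly c {- int M..int M}" for M
  have "incseq s"
    unfolding s_def by (intro incseq_SucI sum_mono2) auto
  then have "Cauchy s"
    using assms by (intro LIMSEQ_imp_Cauchy[OF LIMSEQ_incseq_SUP]) (auto simp: s_def intro!: bdd_aboveI)
  have pd: "(L2_norm (p m - p n))\<^sup>2 = s m - s n" if "n \<le> m" for m n
    using that by (simp add: p_def trig_poly_diff L2_norm_trig_poly s_def sum_diff)
  have "\<exists>N. \<forall>m\<ge>N. \<forall>n\<ge>N. L2_norm (p m - p n) < e" if "e > 0" for e
  proof -
    have "e\<^sup>2 > 0" using that by simp
    from metric_CauchyD[OF \<open>Cauchy s\<close> this] obtain N where N: "\<forall>m\<ge>N. \<forall>n\<ge>N. \<bar>s m - s n\<bar> < e\<^sup>2"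
      unfolding dist_real_def ..
    have "L2_norm (p m - p n) < e" if "m \<ge> N" "n \<ge> N" "n \<le> m" for m n
      using N[rule_format, OF that(1,2)] pd[OF that(3)] \<open>e > 0\<close>
      by (intro power2_less_imp_less[of "L2_norm (p m - p n)" e]) auto
    then have "L2_norm (p m - p n) < e" if "m \<ge> N" "n \<ge> N" for m n
      using that L2_norm_diff_commute[of "p m" "p n"] by (metis nat_le_linear)
    then show ?thesis by blast
  qed
  then obtain F where F: "F \<in> L2" "(\<lambda>n. L2_norm (p n - F)) \<longlonglongrightarrow> 0"
    using L2_complete[of p] by (auto simp: p_def)
  have "fourier_coeff F n = c n" for n
  proof (rule LIMSEQ_unique)
    show "(\<lambda>k. fourier_coeff (p k) n) \<longlonglongrightarrow> fourier_coeff F n"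
      using F by (intro fourier_coeff_tendsto) (auto simp: p_def)
    show "(\<lambda>k. fourier_coeff (p k) n) \<longlonglongrightarrow> c n"
      by (intro tendsto_eventually eventually_sequentiallyI[of "nat \<bar>n\<bar>"])
        (auto simp: p_def fourier_coeff_trig_poly)
  qed
  with F show ?thesis unfolding p_def by blast
qed

lemma Bessel_inequality:
  assumes "f \<in> L2" "finite A"
  shows "(\<Sum>n\<in>A. (cmod (fourier_coeff f n))\<^sup>2) \<le> (L2_norm f)\<^sup>2"
proof -
  define p where "p = trig_poly (fourier_coeff f) A"
  have p: "p \<in> L2" "cinner f p = complex_of_real (\<Sum>n\<in>A. (cmod (fourier_coeff f n))\<^sup>2)"
    using assms by (simp_all add: p_def cinner_trig_poly_right complex_norm_square del: of_real_power)
  have "complex_of_real ((L2_norm (f - p))\<^sup>2) = complex_of_real ((L2_norm f)\<^sup>2 - (\<Sum>n\<in>A. (cmod (fourier_coeff f n))\<^sup>2))"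
    unfolding of_real_diff cinner_self[symmetric]
    using assms p L2_norm_trig_poly[OF assms(2), of "fourier_coeff f", folded p_def]
      cinner_self[of p] cinner_commute[of p f]
    by (simp add: cinner_diff_left cinner_diff_right L2_diff)
  then have "(L2_norm (f - p))\<^sup>2 = (L2_norm f)\<^sup>2 - (\<Sum>n\<in>A. (cmod (fourier_coeff f n))\<^sup>2)"
    by (simp only: of_real_eq_iff)
  then show ?thesis using zero_le_power2[of "L2_norm (f - p)"] by linarith
qed

text \<open>By Bessel the coefficients of \<open>f\<close> are admissible in
  \<open>Riesz_Fischer\<close>; the function obtained there has the same coefficients and so is
  \<open>f\<close>.\<close>

theorem fourier_series_tendsto:
  assumes "f \<in> L2"
  shows "(\<lambda>M. L2_norm (trig_poly (fourier_coeff f) {- int M..int M} - f)) \<longlonglongrightarrow> 0"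
proof -
  obtain F where F: "F \<in> L2" "\<And>n. fourier_coeff F n = fourier_coeff f n"
    "(\<lambda>M. L2_norm (trig_poly (fourier_coeff f) {- int M..int M} - F)) \<longlonglongrightarrow> 0"
    using Riesz_Fischer[of "fourier_coeff f" "(L2_norm f)\<^sup>2"] Bessel_inequality[OF assms] by auto
  then show ?thesis using fourier_coeff_unique[of F f] assms by simp
qed

theorem Parseval:
  assumes "f \<in> L2" "g \<in> L2"
  shows "(\<lambda>M. \<Sum>n\<in>{- int M..int M}. fourier_coeff f n * cnj (fourier_coeff g n)) \<longlonglongrightarrow> cinner f g"
proof -
  have "(\<lambda>M. cinner (trig_poly (fourier_coeff f) {- int M..int M}) g) \<longlonglongrightarrow> cinner f g"
    using assms by (intro cinner_tendsto_left fourier_series_tendsto) auto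
  moreover have "cinner (trig_poly (fourier_coeff f) A) g = (\<Sum>n\<in>A. fourier_coeff f n * cnj (fourier_coeff g n))" for A
    using assms by (subst cinner_commute) (simp add: cinner_trig_poly_right mult.commute)
  ultimately show ?thesis by simp
qed

text \<open>This is Parseval's identity for \<open>f\<close> and \<open>zpow n * conj_fun g\<close>,
  so the product \<open>f * g\<close> itself need not lie in \<open>L2\<close>.\<close>

lemma fourier_coeff_mult:
  assumes "f \<in> L2" "g \<in> L2"
  shows "(\<lambda>M. \<Sum>k\<in>{- int M..int M}. fourier_coeff f k * fourier_coeff g (n - k)) \<longlonglongrightarrow> fourier_coeff (f * g) n"
proof -
  have "zpow n * conj_fun g \<in> L2"
    using assms by (intro ess_bound_L2_mult(1)[OF ess_bound_zpow]) auto
  from Parseval[OF assms(1) this] show ?thesis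
    by (simp add: fourier_coeff_zpow_mult fourier_coeff_conj)
      (simp add: fourier_coeff_eq_cinner[of "f * g"] cinner_def mult_ac)
qed

lemma cinner_eq_0:
  assumes "f \<in> L2" "g \<in> L2" "\<And>n. fourier_coeff f n = 0 \<or> fourier_coeff g n = 0"
  shows "cinner f g = 0"
proof -
  have "(\<lambda>M. \<Sum>n\<in>{- int M..int M}. fourier_coeff f n * cnj (fourier_coeff g n)) = (\<lambda>M. 0)"
    using assms(3) by (intro ext sum.neutral) auto
  with Parseval[OF assms(1,2)] show ?thesis by (simp add: LIMSEQ_const_iff)
qed

section \<open>Schur's algorithm\<close>

unbundle no vec_syntax
unbundle fps_syntax

section \<open>The Hardy spaces in terms of Fourier coefficients\<close>

lemma H2_iff: "f \<in> H2 \<longleftrightarrow> f \<in> L2 \<and> (\<forall>n<0. fourier_coeff f n = 0)"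
  by (simp add: H2_def)

lemma H2_imp_L2: "f \<in> H2 \<Longrightarrow> f \<in> L2"
  by (simp add: H2_iff)

lemma Hinf_iff: "f \<in> Hinf \<longleftrightarrow> f \<in> H2 \<and> (\<exists>C\<ge>0. ess_bound f C)"
  by (auto simp: Hinf_def Linf_iff_ess_bound)

lemma Hinf_imp_H2: "f \<in> Hinf \<Longrightarrow> f \<in> H2"
  by (simp add: Hinf_iff)

lemma fourier_coeff_zero [simp]: "fourier_coeff 0 n = 0"
  by (simp add: fourier_coeff_eq_cinner)

lemma H2_zero [simp]: "0 \<in> H2"
  by (simp add: H2_iff)

lemma fourier_coeff_zpow: "fourier_coeff (zpow m) n = (if m = n then 1 else 0)"
  by (simp add: fourier_coeff_eq_cinner cinner_zpow_zpow)

lemma fourier_coeff_one: "fourier_coeff 1 n = (if n = 0 then 1 else 0)"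
  using fourier_coeff_zpow[of 0 n] by auto

lemma H2_add: "f \<in> H2 \<Longrightarrow> g \<in> H2 \<Longrightarrow> f + g \<in> H2"
  by (simp add: H2_iff L2_add fourier_coeff_add)

lemma H2_diff: "f \<in> H2 \<Longrightarrow> g \<in> H2 \<Longrightarrow> f - g \<in> H2"
  by (simp add: H2_iff L2_diff fourier_coeff_diff)

lemma H2_cscale: "f \<in> H2 \<Longrightarrow> cscale c f \<in> H2"
  by (simp add: H2_iff L2_cscale fourier_coeff_cscale)

lemma H2_zpow: "n \<ge> 0 \<Longrightarrow> zpow n \<in> H2"
  by (simp add: H2_iff fourier_coeff_eq_cinner cinner_zpow_zpow)

lemma Hinf_zpow: "n \<ge> 0 \<Longrightarrow> zpow n \<in> Hinf"
  using H2_zpow ess_bound_zpow[of n] by (auto simp: Hinf_iff intro!: exI[of _ 1])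

lemma Hinf_coord: "coord \<in> Hinf"
  by (simp add: coord_eq_zpow Hinf_zpow)

text \<open>If n < 0, then k or n - k is negative, so every term of the convolution at n
  vanishes.\<close>

lemma Hinf_mult_H2:
  assumes "f \<in> Hinf" "g \<in> H2"
  shows "f * g \<in> H2"
proof -
  have L2: "f * g \<in> L2"
    using assms by (auto simp: Hinf_iff H2_iff intro: ess_bound_L2_mult(1))
  have "fourier_coeff (f * g) n = 0" if "n < 0" for n
  proof -
    have "fourier_coeff f k * fourier_coeff g (n - k) = 0" for k
      using assms that by (cases "k < 0") (auto simp: Hinf_iff H2_iff)
    then have "(\<lambda>M. \<Sum>k\<in>{- int M..int M}. fourier_coeff f k * fourier_coeff g (n - k)) = (\<lambda>M. 0)"
      by (simp only: sum.neutral_const)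
    then show ?thesis
      using fourier_coeff_mult[of f g n] assms by (simp add: Hinf_imp_H2 H2_imp_L2 LIMSEQ_const_iff)
  qed
  with L2 show ?thesis by (simp add: H2_iff)
qed

lemma HinfI: "f \<in> H2 \<Longrightarrow> ess_bound f C \<Longrightarrow> 0 \<le> C \<Longrightarrow> f \<in> Hinf"
  by (auto simp: Hinf_iff)

lemma HinfE:
  assumes "f \<in> Hinf"
  obtains C where "f \<in> H2" "ess_bound f C" "0 \<le> C"
  using assms by (auto simp: Hinf_iff)

lemma Hinf_mult:
  assumes "f \<in> Hinf" "g \<in> Hinf"
  shows "f * g \<in> Hinf"
proof -
  obtain C D where C: "ess_bound f C" "0 \<le> C" and D: "ess_bound g D" "0 \<le> D"
    using assms by (meson HinfE)
  show ?thesis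
    using Hinf_mult_H2[OF assms(1) Hinf_imp_H2[OF assms(2)]] ess_bound_mult[OF C(1) D(1) C(2)]
    by (rule HinfI) (simp add: C D)
qed

lemma Hinf_add:
  assumes "f \<in> Hinf" "g \<in> Hinf"
  shows "f + g \<in> Hinf"
proof -
  obtain C D where C: "ess_bound f C" "0 \<le> C" and D: "ess_bound g D" "0 \<le> D"
    using assms by (meson HinfE)
  show ?thesis
    using H2_add[OF Hinf_imp_H2[OF assms(1)] Hinf_imp_H2[OF assms(2)]] ess_bound_add[OF C(1) D(1)]
    by (rule HinfI) (simp add: C D)
qed

lemma Hinf_cscale:
  assumes "f \<in> Hinf"
  shows "cscale c f \<in> Hinf"
proof -
  obtain C where C: "ess_bound f C" "0 \<le> C"
    using assms by (meson HinfE)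
  show ?thesis
    using H2_cscale[OF Hinf_imp_H2[OF assms]] ess_bound_cscale[OF C(1)]
    by (rule HinfI) (simp add: C)
qed

lemma Hinf_one: "1 \<in> Hinf"
  using Hinf_zpow[of 0] by simp

lemma Hinf_power: "f \<in> Hinf \<Longrightarrow> f ^ n \<in> Hinf"
  by (induction n) (auto intro: Hinf_mult Hinf_one)

text \<open>On \<open>H2\<close> the nonnegative coefficients are all there is. Reading them as a
  formal power series gives access to inverses without any convergence question.\<close>

definition taylor :: "circle_fun \<Rightarrow> complex fps" where
  "taylor f = Abs_fps (\<lambda>n. fourier_coeff f (int n))"

lemma taylor_nth [simp]: "taylor f $ n = fourier_coeff f (int n)"
  by (simp add: taylor_def)

text \<open>The symmetric partial sums of the convolution at n are equal to the finite Cauchy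
  product as soon as M reaches n.\<close>

lemma taylor_mult:
  assumes "f \<in> H2" "g \<in> H2"
  shows "taylor (f * g) = taylor f * taylor g"
proof (rule fps_ext)
  fix n
  have "(\<Sum>k\<in>{- int M..int M}. fourier_coeff f k * fourier_coeff g (int n - k)) = (taylor f * taylor g) $ n"
    if "M \<ge> n" for M
  proof -
    have "(\<Sum>k\<in>{- int M..int M}. fourier_coeff f k * fourier_coeff g (int n - k)) =
      (\<Sum>k\<in>{int 0..int n}. fourier_coeff f k * fourier_coeff g (int n - k))"
      using that assms by (intro sum.mono_neutral_right) (auto simp: H2_iff)
    also have "\<dots> = (\<Sum>i=0..n. fourier_coeff f (int i) * fourier_coeff g (int n - int i))"
      by (subst sum.atLeast_int_atMost_int_shift) simp
    also have "\<dots> = (taylor f * taylor g) $ n"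
      by (simp add: fps_mult_nth of_nat_diff)
    finally show ?thesis .
  qed
  then have "\<forall>\<^sub>F M in sequentially. (\<Sum>k\<in>{- int M..int M}. fourier_coeff f k * fourier_coeff g (int n - k)) = (taylor f * taylor g) $ n"
    by (intro eventually_sequentiallyI[of n])
  then have "(\<lambda>M. \<Sum>k\<in>{- int M..int M}. fourier_coeff f k * fourier_coeff g (int n - k)) \<longlonglongrightarrow> (taylor f * taylor g) $ n"
    by (rule tendsto_eventually)
  then show "taylor (f * g) $ n = (taylor f * taylor g) $ n"
    using LIMSEQ_unique[OF fourier_coeff_mult[of f g "int n"]] assms by (simp add: H2_imp_L2)
qed

lemma taylor_add: "f \<in> L2 \<Longrightarrow> g \<in> L2 \<Longrightarrow> taylor (f + g) = taylor f + taylor g"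
  by (rule fps_ext) (simp add: fourier_coeff_add)

lemma taylor_cscale: "taylor (cscale c f) = fps_const c * taylor f"
  by (rule fps_ext) (simp add: fourier_coeff_cscale)

lemma taylor_one: "taylor 1 = 1"
  by (intro fps_ext) (simp add: fourier_coeff_one)

lemma taylor_coord: "taylor coord = fps_X"
  by (intro fps_ext) (simp add: coord_eq_zpow fourier_coeff_zpow)

section \<open>Moebius transforms of boundary functions\<close>

lemma moebius_norm_le:
  assumes "cmod a < 1" "cmod w \<le> 1"
  shows "cmod ((w + a) / (1 + cnj a * w)) \<le> 1" and "1 + cnj a * w \<noteq> 0"
proof -
  have lt: "cmod (cnj a * w) < 1"
    using mult_left_le[OF assms(2), of "cmod a"] assms(1) by (simp add: norm_mult)
  show 0: "1 + cnj a * w \<noteq> 0"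
  proof
    assume "1 + cnj a * w = 0"
    then have "cnj a * w = - 1" by (simp add: add_eq_0_iff)
    with lt show False by (simp only: norm_minus_cancel norm_one order_less_irrefl)
  qed
  \<comment> \<open>The identity behind the invariance of the closed disc under its automorphisms;
    the same identity reappears for coefficients in \<open>contractive_moebius\<close>.\<close>
  have "complex_of_real ((cmod (1 + cnj a * w))\<^sup>2 - (cmod (w + a))\<^sup>2) =
    complex_of_real ((1 - (cmod a)\<^sup>2) * (1 - (cmod w)\<^sup>2))"
    by (simp add: complex_norm_square algebra_simps del: of_real_power)
  then have "(cmod (1 + cnj a * w))\<^sup>2 - (cmod (w + a))\<^sup>2 = (1 - (cmod a)\<^sup>2) * (1 - (cmod w)\<^sup>2)"
    by (simp only: of_real_eq_iff)
  also have "\<dots> \<ge> 0"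
    using assms by (intro mult_nonneg_nonneg) (auto simp: abs_square_le_1)
  finally have "cmod (w + a) \<le> cmod (1 + cnj a * w)"
    by (intro power2_le_imp_le[OF _ norm_ge_zero]) linarith
  then show "cmod ((w + a) / (1 + cnj a * w)) \<le> 1"
    using 0 unfolding norm_divide by (subst divide_le_eq_1_pos) (simp_all only: zero_less_norm_iff not_False_eq_True)
qed

text \<open>The quotient (w + a) / (1 + cnj a w) is formed on representatives, where the denominator
  is nonzero almost everywhere. It is recorded by its equation, since \<open>circle_fun\<close> has
  no division.\<close>

lemma moebius_ess_bound:
  assumes "ess_bound w 1" "cmod a < 1"
  shows "\<exists>G. ess_bound G 1 \<and> G * (1 + cscale (cnj a) w) = w + cscale a 1"
  using assms
proof transfer
  fix w and a :: complex
  assume w: "ae_eq w w" "AE z in circle_measure. cmod (w z) \<le> 1" and a: "cmod a < 1"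
  then have [measurable]: "w \<in> borel_measurable borel"
    by (auto simp: ae_eq_def)
  let ?G = "\<lambda>z. (w z + a) / (1 + cnj a * w z)"
  have "ae_eq ?G ?G" by (simp add: ae_eq_def)
  moreover have "AE z in circle_measure. cmod (?G z) \<le> 1"
    using w(2) by eventually_elim (rule moebius_norm_le(1)[OF a])
  moreover have "ae_eq (\<lambda>z. ?G z * (1 + cnj a * w z)) (\<lambda>z. w z + a * 1)"
    unfolding ae_eq_def
  proof (intro conjI)
    show "AE z in circle_measure. ?G z * (1 + cnj a * w z) = w z + a * 1"
      using w(2) by eventually_elim (use moebius_norm_le(2)[OF a] in simp)
  qed auto
  ultimately show "\<exists>G\<in>{x. ae_eq x x}. (AE z in circle_measure. cmod (G z) \<le> 1) \<and>
      ae_eq (\<lambda>z. G z * (1 + cnj a * w z)) (\<lambda>z. w z + a * 1)"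
    by (intro bexI[of _ ?G] conjI) auto
qed

text \<open>Iterating \<open>G = q + v G\<close> exhibits \<open>G\<close> as a member of \<open>H\<^sup>\<infinity>\<close> plus a term of norm at most \<open>|a|\<^sup>K\<close>.\<close>

lemma schur_step:
  assumes F: "F \<in> H2" "ess_bound F 1" and a: "cmod a < 1"
  shows "\<exists>G\<in>H2. ess_bound G 1 \<and> G * (1 + cscale (cnj a) (coord * F)) = coord * F + cscale a 1"
proof -
  have w: "ess_bound (coord * F) 1"
    using ess_bound_mult[OF ess_bound_zpow F(2), of 1] by (simp add: coord_eq_zpow)
  obtain G where G: "ess_bound G 1" "G * (1 + cscale (cnj a) (coord * F)) = coord * F + cscale a 1"
    using moebius_ess_bound[OF w a] by blast
  define v where "v = - cscale (cnj a) (coord * F)"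
  define q where "q = coord * F + cscale a 1"
  have F': "F \<in> Hinf" using F by (auto simp: Hinf_iff intro!: exI[of _ 1])
  have v: "v \<in> Hinf" "ess_bound v (cmod a)"
    using Hinf_cscale[OF Hinf_mult[OF Hinf_coord F'], of "- cnj a"] ess_bound_cscale[OF w, of "- cnj a"]
    unfolding v_def by (simp_all add: cscale_minus_one[symmetric])
  have q: "q \<in> Hinf"
    unfolding q_def by (intro Hinf_add Hinf_mult Hinf_cscale Hinf_coord Hinf_one F')
  have eq: "G = q + v * G"
    using G(2) by (simp add: v_def q_def algebra_simps)
  have L2: "G \<in> L2"
    using ess_bound_L2_mult(1)[OF G(1) L2_one] by simp
  have "\<exists>Q\<in>Hinf. G = Q + v ^ K * G" for K
  proof (induction K)
    case 0
    have "0 \<in> Hinf" using Hinf_cscale[OF Hinf_one, of 0] by simp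
    then show ?case by (intro bexI[of _ 0]) auto
  next
    case (Suc K)
    then obtain Q where Q: "Q \<in> Hinf" "G = Q + v ^ K * G" by blast
    have "G = Q + v ^ K * (q + v * G)" using Q(2) eq by simp
    then have "G = (Q + v ^ K * q) + v ^ Suc K * G" by (simp add: algebra_simps)
    then show ?case
      using Q(1) Hinf_add[OF Q(1) Hinf_mult[OF Hinf_power[OF v(1)] q]] by blast
  qed
  note expand = this
  have vK: "ess_bound (v ^ K) (cmod a ^ K)" for K
  proof (induction K)
    case 0
    show ?case using ess_bound_zpow[of 0] by simp
  next
    case (Suc K)
    then show ?case using ess_bound_mult[OF v(2) Suc] by simp
  qed
  have "fourier_coeff G n = 0" if "n < 0" for n
  proof -
    have "cmod (fourier_coeff G n) \<le> cmod a ^ K * L2_norm G" for K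
    proof -
      obtain Q where Q: "Q \<in> Hinf" "G = Q + v ^ K * G" using expand by blast
      have vG: "v ^ K * G \<in> L2" "L2_norm (v ^ K * G) \<le> cmod a ^ K * L2_norm G"
        using ess_bound_L2_mult[OF vK L2] by auto
      have "fourier_coeff G n = fourier_coeff (Q + v ^ K * G) n"
        using Q(2) by simp
      also have "\<dots> = fourier_coeff (v ^ K * G) n"
        using vG(1) Q(1) that by (simp add: fourier_coeff_add Hinf_iff H2_iff)
      finally show ?thesis using fourier_coeff_bound[OF vG(1), of n] vG(2) by simp
    qed
    moreover have "(\<lambda>K. cmod a ^ K * L2_norm G) \<longlonglongrightarrow> 0"
      using a by (intro tendsto_mult_left_zero LIMSEQ_power_zero) auto
    ultimately have "cmod (fourier_coeff G n) \<le> 0"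
      by (intro LIMSEQ_le_const) auto
    then show ?thesis by simp
  qed
  with L2 have "G \<in> H2" by (simp add: H2_iff)
  with G show ?thesis by blast
qed

text \<open>Agreement of the first K coefficients becomes a divisibility, which survives
  multiplication by arbitrary series and cancellation of units.\<close>

lemma fps_X_power_dvd_iff: "fps_X ^ K dvd (h :: complex fps) \<longleftrightarrow> (\<forall>i<K. h $ i = 0)"
proof
  assume "\<forall>i<K. h $ i = 0"
  then have "h = fps_X ^ K * fps_shift K h"
    by (intro fps_ext) (simp add: fps_X_power_mult_nth)
  then show "fps_X ^ K dvd h" by (metis dvd_triv_left)
qed (auto simp: fps_X_power_mult_nth elim!: dvdE)

text \<open>The first N coefficients of \<open>f * g\<close> depend only on those of
  \<open>g\<close>, so this says that the lower triangular N by N Toeplitz matrix with first column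
  \<open>f $ 0\<close>, ..., \<open>f $ (N - 1)\<close> has operator norm at most 1.\<close>

definition contractive :: "nat \<Rightarrow> complex fps \<Rightarrow> bool" where
  "contractive N f \<longleftrightarrow> (\<forall>g :: complex fps. (\<Sum>i<N. (cmod ((f * g) $ i))\<^sup>2) \<le> (\<Sum>i<N. (cmod (g $ i))\<^sup>2))"

text \<open>Substituting h = (1 - cnj a f) g removes the inverse. Coefficient by coefficient, the
  norm defect of the transform on \<open>h\<close> is then 1 - |a|^2 times the defect of
  \<open>f\<close> on \<open>g\<close>. With a = \<open>f $ 0\<close> the denominator has constant
  term 1 - |a|^2, so it is invertible.\<close>

lemma contractive_moebius:
  assumes f: "contractive N f" and a: "a = f $ 0" "cmod a < 1"
  shows "contractive N ((f - fps_const a) * inverse (1 - fps_const (cnj a) * f))"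
  unfolding contractive_def
proof
  fix h :: "complex fps"
  define D where "D = 1 - fps_const (cnj a) * f"
  have "(cmod a)\<^sup>2 < 1" using a(2) by (simp add: abs_square_less_1)
  then have "complex_of_real ((cmod a)\<^sup>2) \<noteq> 1" by (metis of_real_eq_1_iff order_less_irrefl)
  then have "D $ 0 \<noteq> 0"
    using a(1) by (simp add: D_def complex_norm_square mult.commute del: of_real_power)
  then have D: "inverse D * D = 1" by (rule inverse_mult_eq_1)
  define g where "g = inverse D * h"
  have h: "h = g - fps_const (cnj a) * (f * g)"
  proof -
    have "D * g = h" using D by (simp add: g_def mult.assoc[symmetric] mult.commute[of D])
    then show ?thesis by (simp add: D_def algebra_simps)
  qed
  have fh: "(f - fps_const a) * inverse D * h = f * g - fps_const a * g"
    by (simp add: g_def algebra_simps)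
  have id: "(cmod (y - cnj a * x))\<^sup>2 - (cmod (x - a * y))\<^sup>2 = (1 - (cmod a)\<^sup>2) * ((cmod y)\<^sup>2 - (cmod x)\<^sup>2)" for x y
  proof -
    have "complex_of_real ((cmod (y - cnj a * x))\<^sup>2 - (cmod (x - a * y))\<^sup>2) =
      complex_of_real ((1 - (cmod a)\<^sup>2) * ((cmod y)\<^sup>2 - (cmod x)\<^sup>2))"
      by (simp add: complex_norm_square algebra_simps del: of_real_power)
    then show ?thesis by (simp only: of_real_eq_iff)
  qed
  have "(\<Sum>i<N. (cmod (h $ i))\<^sup>2) - (\<Sum>i<N. (cmod ((f * g - fps_const a * g) $ i))\<^sup>2) =
    (1 - (cmod a)\<^sup>2) * ((\<Sum>i<N. (cmod (g $ i))\<^sup>2) - (\<Sum>i<N. (cmod ((f * g) $ i))\<^sup>2))"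
    unfolding h by (simp add: id sum_distrib_left flip: sum_subtractf)
  also have "\<dots> \<ge> 0"
    using f \<open>(cmod a)\<^sup>2 < 1\<close> by (intro mult_nonneg_nonneg) (auto simp: contractive_def)
  finally show "(\<Sum>i<N. (cmod (((f - fps_const a) * inverse (1 - fps_const (cnj a) * f) * h) $ i))\<^sup>2) \<le> (\<Sum>i<N. (cmod (h $ i))\<^sup>2)"
    using fh by (simp add: D_def)
qed

lemma contractive_shift:
  assumes "contractive (Suc N) (fps_X * f)"
  shows "contractive N f"
  unfolding contractive_def
proof
  fix g :: "complex fps"
  \<comment> \<open>The hypothesis involves N + 1 coefficients; the cutoff removes the last one of
    \<open>g\<close> from the right-hand side and leaves the first N coefficients of the product
    unchanged.\<close>
  define g' where "g' = fps_cutoff N g"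
  have "(\<Sum>i<N. (cmod ((f * g) $ i))\<^sup>2) = (\<Sum>i<N. (cmod ((fps_X * f * g') $ Suc i))\<^sup>2)"
  proof (intro sum.cong refl)
    fix i assume "i \<in> {..<N}"
    then have "(f * g) $ i = (f * g') $ i"
      by (auto simp: fps_mult_nth g'_def intro!: sum.cong)
    also have "\<dots> = (fps_X * f * g') $ Suc i"
      by (simp add: mult.assoc)
    finally show "(cmod ((f * g) $ i))\<^sup>2 = (cmod ((fps_X * f * g') $ Suc i))\<^sup>2"
      by simp
  qed
  also have "\<dots> \<le> (\<Sum>i<Suc N. (cmod ((fps_X * f * g') $ i))\<^sup>2)"
    by (subst sum.lessThan_Suc_shift) simp
  also have "\<dots> \<le> (\<Sum>i<Suc N. (cmod (g' $ i))\<^sup>2)"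
    using assms by (simp only: contractive_def)
  also have "\<dots> = (\<Sum>i<N. (cmod (g $ i))\<^sup>2)"
    by (simp add: g'_def)
  finally show "(\<Sum>i<N. (cmod ((f * g) $ i))\<^sup>2) \<le> (\<Sum>i<N. (cmod (g $ i))\<^sup>2)" .
qed

text \<open>Induction on N by Schur's step: subtract a = \<open>f $ 0\<close> by a Moebius map,
  divide by X, interpolate the remaining N coefficients by \<open>F\<close>, and return through G =
  (z F + a) / (1 + cnj a z F). If |a| = 1, the data already force a constant.\<close>

theorem Schur_interpolation:
  assumes "contractive N f"
  shows "\<exists>F\<in>H2. ess_bound F 1 \<and> (\<forall>i<N. fourier_coeff F (int i) = f $ i)"
  using assms
proof (induction N arbitrary: f)
  case 0
  have "ess_bound 0 1" using ess_bound_cscale[OF ess_bound_zpow[of 0], of 0] 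
    by transfer simp
  then show ?case by (intro bexI[of _ 0]) auto
next
  case (Suc N)
  define a where "a = f $ 0"
  \<comment> \<open>Contractivity tested on the series 1: the first column of the matrix has norm at
    most 1.\<close>
  have sum1: "(\<Sum>i<Suc N. (cmod (f $ i))\<^sup>2) \<le> 1"
    using Suc.prems[unfolded contractive_def, rule_format, of 1]
    by (subst (asm) (2) sum.lessThan_Suc_shift) simp
  have split: "(\<Sum>i<Suc N. (cmod (f $ i))\<^sup>2) = (cmod a)\<^sup>2 + (\<Sum>i<N. (cmod (f $ Suc i))\<^sup>2)"
    by (subst sum.lessThan_Suc_shift) (simp add: a_def)
  have "(cmod a)\<^sup>2 \<le> 1" using sum1 split sum_nonneg[of "{..<N}" "\<lambda>i. (cmod (f $ Suc i))\<^sup>2"] by simp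
  then have "cmod a \<le> 1" by (simp add: abs_square_le_1)
  show ?case
  proof (cases "cmod a = 1")
    case True
    \<comment> \<open>The entry \<open>a\<close> already uses up the whole norm of the first
      column.\<close>
    have "(\<Sum>i<N. (cmod (f $ Suc i))\<^sup>2) = 0"
      using sum1 split True sum_nonneg[of "{..<N}" "\<lambda>i. (cmod (f $ Suc i))\<^sup>2"] by simp
    then have z: "f $ Suc i = 0" if "i < N" for i
      using that by (subst (asm) sum_nonneg_eq_0_iff) auto
    have "fourier_coeff (cscale a 1) (int i) = f $ i" if "i < Suc N" for i
      using z[of "i - 1"] that
      by (cases i) (auto simp: fourier_coeff_cscale fourier_coeff_one a_def)
    moreover have "ess_bound (cscale a 1) 1"
      using ess_bound_cscale[OF ess_bound_zpow[of 0], of a] True by simp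
    moreover have "cscale a 1 \<in> H2"
      using H2_cscale[OF Hinf_imp_H2[OF Hinf_one]] .
    ultimately show ?thesis by blast
  next
    case False
    with \<open>cmod a \<le> 1\<close> have a: "cmod a < 1" by simp
    define D where "D = 1 - fps_const (cnj a) * f"
    define \<phi> where "\<phi> = (f - fps_const a) * inverse D"
    have "(cmod a)\<^sup>2 < 1" using a by (simp add: abs_square_less_1)
    then have "complex_of_real ((cmod a)\<^sup>2) \<noteq> 1" by (metis of_real_eq_1_iff order_less_irrefl)
    then have "D $ 0 \<noteq> 0"
      by (simp add: D_def a_def complex_norm_square mult.commute del: of_real_power)
    then have D: "inverse D * D = 1" by (rule inverse_mult_eq_1)
    have "\<phi> $ 0 = 0" by (simp add: \<phi>_def a_def)
    define \<phi>' where "\<phi>' = fps_shift 1 \<phi>"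
    have \<phi>': "\<phi> = fps_X * \<phi>'"
      using \<open>\<phi> $ 0 = 0\<close> by (intro fps_ext) (simp add: \<phi>'_def)
    have "contractive (Suc N) \<phi>"
      using contractive_moebius[OF Suc.prems a_def a] by (simp add: \<phi>_def D_def)
    then have "contractive N \<phi>'"
      using contractive_shift \<phi>' by simp
    then obtain F where F: "F \<in> H2" "ess_bound F 1" "\<forall>i<N. fourier_coeff F (int i) = \<phi>' $ i"
      using Suc.IH by blast
    obtain G where G: "G \<in> H2" "ess_bound G 1" "G * (1 + cscale (cnj a) (coord * F)) = coord * F + cscale a 1"
      using schur_step[OF F(1,2) a] by blast
    have zF: "coord * F \<in> H2" by (rule Hinf_mult_H2[OF Hinf_coord F(1)])
    have one: "1 \<in> H2" by (rule Hinf_imp_H2[OF Hinf_one])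
    \<comment> \<open>\<open>U\<close> and \<open>V\<close> are the denominators of the inverse
      Moebius map for \<open>F\<close> and for its prescribed coefficients. The error
      \<open>E\<close> vanishes to order N + 1, one more than the agreement of \<open>F\<close>,
      because of the factor \<open>fps_X\<close>.\<close>
    define U where "U = 1 + fps_const (cnj a) * (fps_X * taylor F)"
    define V where "V = 1 + fps_const (cnj a) * (fps_X * \<phi>')"
    define E where "E = fps_X * (taylor F - \<phi>')"
    have "taylor (G * (1 + cscale (cnj a) (coord * F))) = taylor (coord * F + cscale a 1)"
      using G(3) by simp
    then have GU: "taylor G * U = fps_X * taylor F + fps_const a"
      using G(1) zF one F(1)
      by (simp add: taylor_mult taylor_add taylor_cscale taylor_coord taylor_one H2_add H2_cscale H2_imp_L2 
        Hinf_imp_H2[OF Hinf_coord] L2_cscale U_def)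
    have fV: "f * V = fps_X * \<phi>' + fps_const a"
    proof -
      have "\<phi> * D = f - fps_const a" using D by (simp add: \<phi>_def mult.assoc)
      then show ?thesis unfolding V_def D_def \<phi>'[symmetric] by (simp add: algebra_simps)
    qed
    have E: "fps_X ^ Suc N dvd E"
      using F(3) by (auto simp: fps_X_power_dvd_iff E_def)
    \<comment> \<open>Clearing denominators makes the difference a multiple of \<open>E\<close>;
      afterwards \<open>V\<close> is cancelled, being a unit with constant term 1.\<close>
    have "(taylor G - f) * V = taylor G * U - f * V - taylor G * (U - V)"
      by (simp add: algebra_simps)
    moreover have "taylor G * U - f * V = E"
      by (simp only: GU fV E_def) (simp add: right_diff_distrib)
    moreover have "U - V = fps_const (cnj a) * E"
      by (simp add: U_def V_def E_def algebra_simps)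
    ultimately have "(taylor G - f) * V = E - taylor G * (fps_const (cnj a) * E)"
      by simp
    then have "fps_X ^ Suc N dvd (taylor G - f) * V"
      using E by simp
    then have "fps_X ^ Suc N dvd ((taylor G - f) * V) * inverse V"
      by (rule dvd_mult2)
    moreover have "V * inverse V = 1"
      by (subst mult.commute, rule inverse_mult_eq_1) (simp add: V_def)
    ultimately have "fps_X ^ Suc N dvd (taylor G - f)"
      by (simp only: mult.assoc mult.right_neutral)
    then have "\<forall>i<Suc N. fourier_coeff G (int i) = f $ i"
      by (simp only: fps_X_power_dvd_iff fps_sub_nth taylor_nth right_minus_eq)
    with G show ?thesis by blast
  qed
qed

section \<open>Nehari's theorem\<close>

lemma L2_norm_ess_bound: "ess_bound u C \<Longrightarrow> 0 \<le> C \<Longrightarrow> u \<in> L2 \<and> L2_norm u \<le> C"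
  using ess_bound_L2_mult[of u C 1] L2_norm_zpow[of 0] by simp

text \<open>Against a partial Fourier sum of \<open>g\<close> only finitely many coefficients
  matter; the remainder of \<open>g\<close> is small in norm and is controlled uniformly in k by
  Cauchy-Schwarz.\<close>

lemma weak_convergence:
  assumes u: "\<And>k. u k \<in> L2" "\<And>k. L2_norm (u k) \<le> B" and v: "v \<in> L2" and g: "g \<in> L2"
    and lim: "\<And>n. (\<lambda>k. fourier_coeff (u k) n) \<longlonglongrightarrow> fourier_coeff v n"
  shows "(\<lambda>k. cinner (u k) g) \<longlonglongrightarrow> cinner v g"
proof (rule LIMSEQ_I)
  fix e :: real assume e: "e > 0"
  \<comment> \<open>A bound for the norm of \<open>u k - v\<close>; the summand 1 makes it
    positive.\<close>
  define K where "K = B + L2_norm v + 1"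
  have K: "K > 0" using u(2)[of 0] L2_norm_nonneg[of "u 0"] L2_norm_nonneg[of v] unfolding K_def by linarith
  define S where "S M = trig_poly (fourier_coeff g) {- int M..int M}" for M
  have S: "S M \<in> L2" for M by (simp add: S_def)
  have "\<forall>\<^sub>F M in sequentially. L2_norm (S M - g) < e / (2 * K)"
    using fourier_series_tendsto[OF g] e K by (intro order_tendstoD(2)[of _ 0]) (auto simp: S_def)
  then obtain M where M: "L2_norm (S M - g) < e / (2 * K)"
    by (auto simp: eventually_sequentially)
  have "(\<lambda>k. cinner (u k) (S M) - cinner v (S M)) \<longlonglongrightarrow> cinner v (S M) - cinner v (S M)"
    unfolding S_def cinner_trig_poly_right[OF u(1)] cinner_trig_poly_right[OF v]
    by (intro tendsto_intros lim)
  then have "\<forall>\<^sub>F k in sequentially. norm (cinner (u k) (S M) - cinner v (S M)) < e / 2"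
    using e by (intro order_tendstoD(2)[of _ 0]) (auto simp: tendsto_norm_zero_iff)
  then obtain k0 where k0: "\<And>k. k \<ge> k0 \<Longrightarrow> norm (cinner (u k) (S M) - cinner v (S M)) < e / 2"
    by (auto simp: eventually_sequentially)
  have "norm (cinner (u k) g - cinner v g) < e" if "k \<ge> k0" for k
  proof -
    have d: "u k - v \<in> L2" "g - S M \<in> L2" using u v g S by (auto intro: L2_diff)
    have "L2_norm (u k - v) \<le> K"
    proof -
      have "L2_norm (u k - v) \<le> L2_norm (u k - 0) + L2_norm (0 - v)"
        using u v by (intro L2_norm_triangle_diff) auto
      also have "L2_norm (0 - v) = L2_norm v" using L2_norm_diff_commute[of 0 v] by simp
      finally show ?thesis using u(2)[of k] by (simp add: K_def)
    qed
    then have "L2_norm (u k - v) * L2_norm (g - S M) \<le> K * (e / (2 * K))"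
      using M K by (intro mult_mono) (auto simp: L2_norm_diff_commute[of g])
    then have "norm (cinner (u k - v) (g - S M)) \<le> e / 2"
      using cinner_Cauchy_Schwarz[OF d] K by simp
    moreover have "cinner (u k) g - cinner v g = cinner (u k - v) (g - S M) + (cinner (u k) (S M) - cinner v (S M))"
      using u v g S by (simp add: cinner_diff_left cinner_diff_right L2_diff)
    ultimately show ?thesis
      using k0[OF that] norm_triangle_ineq[of "cinner (u k - v) (g - S M)" "cinner (u k) (S M) - cinner v (S M)"]
      by simp
  qed
  then show "\<exists>no. \<forall>k\<ge>no. norm (cinner (u k) g - cinner v g) < e" by blast
qed

text \<open>The test function is the indicator of the set where |v| exceeds C. There the reverse
  inequality holds pointwise and strictly, so the set is null.\<close>

lemma multiplier_ess_bound:
  assumes "v \<in> L2" "0 \<le> C" and "\<And>p. ess_bound p 1 \<Longrightarrow> L2_norm (v * p) \<le> C * L2_norm p"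
  shows "ess_bound v C"
proof -
  have "sq_integral (v * p) \<le> C\<^sup>2 * sq_integral p" if "ess_bound p 1" for p
    using power_mono[OF assms(3)[OF that], of 2] by (simp add: L2_norm_power2 power_mult_distrib)
  moreover have "square_integrable v" using assms by (simp add: L2_def)
  ultimately show ?thesis
    using \<open>0 \<le> C\<close>
  proof transfer
    fix v :: "complex \<Rightarrow> complex" and C :: real
    let ?M = circle_measure
    assume v: "ae_eq v v" "integrable ?M (\<lambda>z. (cmod (v z))\<^sup>2)" and C: "0 \<le> C"
      and le: "\<And>p. ae_eq p p \<Longrightarrow> AE z in ?M. cmod (p z) \<le> 1 \<Longrightarrow>
        (\<integral>z. (cmod (v z * p z))\<^sup>2 \<partial>?M) \<le> C\<^sup>2 * (\<integral>z. (cmod (p z))\<^sup>2 \<partial>?M)"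
    from v have [measurable]: "v \<in> borel_measurable borel" by (auto simp: ae_eq_def)
    define E where "E = {z. C < cmod (v z)}"
    have [measurable]: "E \<in> sets borel" unfolding E_def by measurable
    define p :: "complex \<Rightarrow> complex" where "p = indicator E"
    have p [measurable]: "p \<in> borel_measurable borel" unfolding p_def by measurable
    have "(\<integral>z. (cmod (v z * p z))\<^sup>2 \<partial>?M) \<le> C\<^sup>2 * (\<integral>z. (cmod (p z))\<^sup>2 \<partial>?M)"
      by (rule le) (auto simp: ae_eq_def p_def indicator_def)
    moreover have i: "integrable ?M (\<lambda>z. (cmod (v z * p z))\<^sup>2)"
      by (rule Bochner_Integration.integrable_bound[OF v(2)]) (auto simp: p_def indicator_def)
    moreover have i2: "integrable ?M (\<lambda>z. C\<^sup>2 * (cmod (p z))\<^sup>2)"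
      by (intro integrable_mult_right circle.integrable_const_bound[of _ 1]) (auto simp: p_def indicator_def)
    ultimately have "(\<integral>z. (cmod (v z * p z))\<^sup>2 - C\<^sup>2 * (cmod (p z))\<^sup>2 \<partial>?M) \<le> 0"
      by (subst Bochner_Integration.integral_diff) auto
    moreover have nn: "0 \<le> (cmod (v z * p z))\<^sup>2 - C\<^sup>2 * (cmod (p z))\<^sup>2" for z
      using C by (auto simp: p_def E_def indicator_def intro!: power_mono)
    ultimately have "(\<integral>z. (cmod (v z * p z))\<^sup>2 - C\<^sup>2 * (cmod (p z))\<^sup>2 \<partial>?M) = 0"
      by (intro antisym integral_nonneg_AE) auto
    then have "AE z in ?M. (cmod (v z * p z))\<^sup>2 - C\<^sup>2 * (cmod (p z))\<^sup>2 = 0"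
      using i i2 nn by (subst (asm) integral_nonneg_eq_0_iff_AE) auto
    then show "AE z in ?M. cmod (v z) \<le> C"
    proof eventually_elim
      case (elim z)
      then show ?case
        using C power_strict_mono[of C "cmod (v z)" 2] by (auto simp: p_def E_def indicator_def not_less[symmetric])
    qed
  qed
qed

text \<open>The coefficient sequences lie in a countable product of closed discs, which is
  sequentially compact. Bessel's inequality passes to the limit, Riesz-Fischer realises the limiting
  coefficients, and the essential bound is recovered through
  \<open>multiplier_ess_bound\<close>.\<close>

lemma weak_star_compact:
  assumes u: "\<And>k. ess_bound (u k) C" and C: "0 \<le> C"
  shows "\<exists>v r. strict_mono (r :: nat \<Rightarrow> nat) \<and> v \<in> L2 \<and> ess_bound v C \<and>
    (\<forall>n. (\<lambda>k. fourier_coeff (u (r k)) n) \<longlonglongrightarrow> fourier_coeff v n)"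
proof -
  have uL2: "u k \<in> L2" "L2_norm (u k) \<le> C" for k
    using L2_norm_ess_bound[OF u C] by auto
  let ?K = "PiE UNIV (\<lambda>_::int. cball 0 C) :: (int \<Rightarrow> complex) set"
  have "compactin (product_topology (\<lambda>_::int. euclidean :: complex topology) UNIV) ?K"
    by (subst compactin_PiE) auto
  then have "compact ?K"
    by (simp add: euclidean_product_topology)
  then have "seq_compact ?K" by (rule compact_imp_seq_compact)
  moreover have "\<forall>k. fourier_coeff (u k) \<in> ?K"
    using uL2 fourier_coeff_bound order_trans by (auto simp: PiE_iff) blast
  ultimately obtain c r where r: "strict_mono (r :: nat \<Rightarrow> nat)"
    and c: "((\<lambda>k. fourier_coeff (u k)) \<circ> r) \<longlonglongrightarrow> c"
    by (rule seq_compactE)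
  have lim: "(\<lambda>k. fourier_coeff (u (r k)) n) \<longlonglongrightarrow> c n" for n
    using continuous_on_tendsto_compose[OF continuous_on_product_coordinates c, of n] by (simp add: o_def)
  have "(\<Sum>n\<in>{- int M..int M}. (cmod (c n))\<^sup>2) \<le> C\<^sup>2" for M
  proof (rule LIMSEQ_le_const2)
    show "(\<lambda>k. \<Sum>n\<in>{- int M..int M}. (cmod (fourier_coeff (u (r k)) n))\<^sup>2) \<longlonglongrightarrow> (\<Sum>n\<in>{- int M..int M}. (cmod (c n))\<^sup>2)"
      by (intro tendsto_intros lim)
    have "(\<Sum>n\<in>{- int M..int M}. (cmod (fourier_coeff (u (r k)) n))\<^sup>2) \<le> C\<^sup>2" for k
      by (rule order_trans[OF Bessel_inequality[OF uL2(1)]]) (auto intro!: power_mono uL2)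
    then show "\<exists>N. \<forall>k\<ge>N. (\<Sum>n\<in>{- int M..int M}. (cmod (fourier_coeff (u (r k)) n))\<^sup>2) \<le> C\<^sup>2" by blast
  qed
  from Riesz_Fischer[OF this] obtain v where v: "v \<in> L2" "\<And>n. fourier_coeff v n = c n" by blast
  have weak: "(\<lambda>k. cinner (u (r k)) g) \<longlonglongrightarrow> cinner v g" if "g \<in> L2" for g
    using that v lim uL2 by (intro weak_convergence[of "\<lambda>k. u (r k)" C]) auto
  have "ess_bound v C"
  proof (rule multiplier_ess_bound[OF v(1) C])
    fix p assume p: "ess_bound p 1"
    have q: "v * p \<in> L2" using ess_bound_L2_mult(1)[OF p v(1)] by (simp add: mult.commute)
    have pL2: "p \<in> L2" using L2_norm_ess_bound[OF p] by simp
    \<comment> \<open>The test function is chosen so that the pairing with \<open>u (r k)\<close> is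
      that of \<open>u (r k) * p\<close> with \<open>v * p\<close>, while the limit is the squared
      norm of \<open>v * p\<close>.\<close>
    have "conj_fun p * (v * p) \<in> L2"
      using ess_bound_L2_mult(1)[OF _ q, of "conj_fun p" 1] p by simp
    from weak[OF this] have "(\<lambda>k. norm (cinner (u (r k)) (conj_fun p * (v * p)))) \<longlonglongrightarrow> norm (cinner v (conj_fun p * (v * p)))"
      by (rule tendsto_norm)
    moreover have "norm (cinner (u (r k)) (conj_fun p * (v * p))) \<le> C * L2_norm p * L2_norm (v * p)" for k
    proof -
      have up: "u (r k) * p \<in> L2" "L2_norm (u (r k) * p) \<le> C * L2_norm p"
        using ess_bound_L2_mult[OF u pL2 C] by auto
      have "norm (cinner (u (r k)) (conj_fun p * (v * p))) = norm (cinner (u (r k) * p) (v * p))"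
        by (simp add: cinner_def mult_ac)
      also have "\<dots> \<le> L2_norm (u (r k) * p) * L2_norm (v * p)"
        by (rule cinner_Cauchy_Schwarz[OF up(1) q])
      also have "\<dots> \<le> C * L2_norm p * L2_norm (v * p)"
        by (intro mult_right_mono up(2)) simp
      finally show ?thesis .
    qed
    ultimately have "norm (cinner v (conj_fun p * (v * p))) \<le> C * L2_norm p * L2_norm (v * p)"
      by (intro LIMSEQ_le_const2) auto
    moreover have "cinner v (conj_fun p * (v * p)) = complex_of_real ((L2_norm (v * p))\<^sup>2)"
      by (simp add: cinner_def mult_ac del: of_real_power flip: cinner_self)
    ultimately have "L2_norm (v * p) * L2_norm (v * p) \<le> C * L2_norm p * L2_norm (v * p)"
      by (simp add: power2_eq_square norm_mult)
    then show "L2_norm (v * p) \<le> C * L2_norm p"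
      using C L2_norm_nonneg[of "v * p"] by (cases "L2_norm (v * p) = 0") (auto simp: mult_le_cancel_right)
  qed
  with r v lim show ?thesis by (intro exI[of _ v] exI[of _ r]) simp
qed

text \<open>
  The Fejer weight \<open>(i - j + 1) / N\<close> is the proportion of those \<open>k < N\<close> with \<open>j \<le> k \<le> i\<close>; hence the weighted
  triangular matrix is an average over \<open>k\<close> of corners of the Hankel matrix.
\<close>

lemma fejer_contractive:
  fixes \<alpha> :: "nat \<Rightarrow> complex"
  assumes C: "C > 0" and N: "N > 0"
    and hankel: "\<And>x y. cmod (\<Sum>j<N. \<Sum>i<N. x j * y i * \<alpha> (j + i + 1)) \<le>
      C * sqrt (\<Sum>j<N. (cmod (x j))\<^sup>2) * sqrt (\<Sum>i<N. (cmod (y i))\<^sup>2)"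
  shows "contractive N (Abs_fps (\<lambda>i. of_nat (i + 1) * \<alpha> (N - i) / complex_of_real (N * C)))"
  unfolding contractive_def
proof
  fix g :: "complex fps"
  define f where "f = Abs_fps (\<lambda>i. of_nat (i + 1) * \<alpha> (N - i) / complex_of_real (N * C))"
  define y where "y i = (f * g) $ i" for i
  define S where "S = (\<Sum>i<N. (cmod (y i))\<^sup>2)"
  define G where "G = (\<Sum>i<N. (cmod (g $ i))\<^sup>2)"
  have nonneg: "0 \<le> S" "0 \<le> G" by (simp_all add: S_def G_def sum_nonneg)
  \<comment> \<open>Reversing the index i turns Hankel into Toeplitz: for j \<le> i < N the argument
    of \<alpha> is N - (i - j). The two conditions cut out the corner j \<le> k \<le> i.\<close>
  define t where "t k j i = (if j \<le> k then g $ j else 0) * (if k \<le> i then cnj (y i) else 0) * \<alpha> (j + (N - Suc i) + 1)"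
    for k j i
  define T where "T k = (\<Sum>j<N. \<Sum>i<N. t k j i)" for k
  have T_le: "cmod (T k) \<le> C * sqrt G * sqrt S" for k
  proof -
    define x where "x j = (if j \<le> k then g $ j else 0)" for j
    define z where "z i = (if k \<le> N - Suc i then cnj (y (N - Suc i)) else 0)" for i
    have "T k = (\<Sum>j<N. \<Sum>i<N. t k j (N - Suc i))"
      unfolding T_def by (intro sum.cong refl sum.nat_diff_reindex[symmetric])
    also have "\<dots> = (\<Sum>j<N. \<Sum>i<N. x j * z i * \<alpha> (j + i + 1))"
      by (intro sum.cong refl) (simp add: t_def x_def z_def)
    finally have "cmod (T k) \<le> C * sqrt (\<Sum>j<N. (cmod (x j))\<^sup>2) * sqrt (\<Sum>i<N. (cmod (z i))\<^sup>2)"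
      using hankel[of x z] by simp
    also have "\<dots> \<le> C * sqrt G * sqrt S"
    proof (intro mult_mono real_sqrt_le_mono)
      show "(\<Sum>j<N. (cmod (x j))\<^sup>2) \<le> G"
        unfolding G_def by (intro sum_mono) (auto simp: x_def)
      have "(\<Sum>i<N. (cmod (z i))\<^sup>2) \<le> (\<Sum>i<N. (cmod (y (N - Suc i)))\<^sup>2)"
        by (intro sum_mono) (auto simp: z_def)
      also have "\<dots> = S"
        unfolding S_def by (rule sum.nat_diff_reindex)
      finally show "(\<Sum>i<N. (cmod (z i))\<^sup>2) \<le> S" .
    qed (use C nonneg in \<open>auto intro!: sum_nonneg\<close>)
    finally show ?thesis .
  qed
  \<comment> \<open>The form is paired with the conjugate of y = f g itself, so the averaged matrix
    returns the squared norm \<open>S\<close>; the factor N C is the denominator of the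
    weights.\<close>
  have "(\<Sum>k<N. T k) = complex_of_real (N * C) * complex_of_real S"
  proof -
    have "(\<Sum>k<N. T k) = (\<Sum>i<N. \<Sum>j<N. \<Sum>k<N. t k j i)"
    proof -
      have "(\<Sum>k<N. T k) = (\<Sum>k<N. \<Sum>i<N. \<Sum>j<N. t k j i)"
        unfolding T_def by (intro sum.cong refl sum.swap)
      also have "\<dots> = (\<Sum>i<N. \<Sum>k<N. \<Sum>j<N. t k j i)" by (rule sum.swap)
      also have "\<dots> = (\<Sum>i<N. \<Sum>j<N. \<Sum>k<N. t k j i)"
        by (intro sum.cong refl sum.swap)
      finally show ?thesis .
    qed
    also have "\<dots> = (\<Sum>i<N. complex_of_real (N * C) * (cnj (y i) * y i))"
    proof (intro sum.cong refl)
      fix i assume "i \<in> {..<N}"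
      then have i: "i < N" by simp
      have "(\<Sum>k<N. t k j i) = (if j \<le> i then complex_of_real (N * C) * cnj (y i) * (g $ j * f $ (i - j)) else 0)" for j
      proof -
        have "(\<Sum>k<N. t k j i) = (\<Sum>k\<in>{j..i}. g $ j * cnj (y i) * \<alpha> (j + (N - Suc i) + 1))"
          using i by (intro sum.mono_neutral_cong_right) (auto simp: t_def)
        also have "\<dots> = of_nat (Suc i - j) * (g $ j * cnj (y i) * \<alpha> (j + (N - Suc i) + 1))"
          by simp
        also have "\<dots> = (if j \<le> i then complex_of_real (N * C) * cnj (y i) * (g $ j * f $ (i - j)) else 0)"
        proof (cases "j \<le> i")
          case True
          then have *: "j + (N - Suc i) + 1 = N - (i - j)" "Suc i - j = i - j + 1" using i by auto
          have "complex_of_real (N * C) \<noteq> 0" using C N by simp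
          then show ?thesis
            unfolding * f_def using True by (simp add: field_simps)
        qed simp
        finally show ?thesis .
      qed
      then have "(\<Sum>j<N. \<Sum>k<N. t k j i) = (\<Sum>j\<in>{0..i}. complex_of_real (N * C) * cnj (y i) * (g $ j * f $ (i - j)))"
        using i by (simp only:) (intro sum.mono_neutral_cong_right, auto)
      also have "\<dots> = complex_of_real (N * C) * cnj (y i) * (g * f) $ i"
        by (simp only: fps_mult_nth sum_distrib_left)
      finally show "(\<Sum>j<N. \<Sum>k<N. t k j i) = complex_of_real (N * C) * (cnj (y i) * y i)"
        by (simp add: y_def mult.commute[of g] mult.assoc)
    qed
    also have "\<dots> = complex_of_real (N * C) * complex_of_real S"
      by (simp add: S_def sum_distrib_left complex_norm_square mult.commute[of "cnj _"] del: of_real_power)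
    finally show ?thesis .
  qed
  then have "N * C * S = cmod (\<Sum>k<N. T k)"
    using C nonneg by (simp add: norm_mult)
  also have "\<dots> \<le> (\<Sum>k<N. C * sqrt G * sqrt S)"
    by (rule order_trans[OF norm_sum]) (intro sum_mono T_le)
  finally have "N * C * S \<le> N * C * (sqrt G * sqrt S)" by simp
  then have "S \<le> sqrt G * sqrt S" using N C by simp
  then have le: "sqrt S * sqrt S \<le> sqrt G * sqrt S" using nonneg by simp
  have "S \<le> G"
  proof (cases "S = 0")
    case False
    then have "0 < sqrt S" using nonneg by simp
    then have "sqrt S \<le> sqrt G" using le by (rule mult_right_le_imp_le[rotated])
    then show ?thesis by simp
  qed (use nonneg in simp)
  then show "(\<Sum>i<N. (cmod ((Abs_fps (\<lambda>i. of_nat (i + 1) * \<alpha> (N - i) / complex_of_real (N * C)) * g) $ i))\<^sup>2)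
    \<le> (\<Sum>i<N. (cmod (g $ i))\<^sup>2)"
    by (simp only: S_def G_def y_def f_def)
qed

text \<open>The hypothesis bounds all finite corners of the Hankel matrix by C. Only the negative
  coefficients of \<open>u\<close> are prescribed; the others are whatever Schur's algorithm and the
  weak limit produce, and this freedom is what permits the bound C.\<close>

theorem Nehari:
  fixes \<alpha> :: "nat \<Rightarrow> complex"
  assumes C: "C > 0"
    and hankel: "\<And>N x y. cmod (\<Sum>j<N. \<Sum>i<N. x j * y i * \<alpha> (j + i + 1)) \<le>
      C * sqrt (\<Sum>j<N. (cmod (x j))\<^sup>2) * sqrt (\<Sum>i<N. (cmod (y i))\<^sup>2)"
  shows "\<exists>u\<in>L2. ess_bound u C \<and> (\<forall>m>0. fourier_coeff u (- int m) = \<alpha> m)"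
proof -
  have "\<exists>u. ess_bound u C \<and> (\<forall>m>0. m \<le> Suc N \<longrightarrow>
      fourier_coeff u (- int m) = of_real ((Suc N - m + 1) / Suc N) * \<alpha> m)" for N
  proof -
    let ?N = "Suc N"
    define f where "f = Abs_fps (\<lambda>i. of_nat (i + 1) * \<alpha> (?N - i) / complex_of_real (?N * C))"
    have "contractive ?N f"
      unfolding f_def by (rule fejer_contractive[OF C _ hankel]) simp
    then obtain F where F: "F \<in> H2" "ess_bound F 1" "\<And>i. i < ?N \<Longrightarrow> fourier_coeff F (int i) = f $ i"
      using Schur_interpolation by blast
    \<comment> \<open>The coefficient N - m of \<open>F\<close> moves to -m, and the factor C undoes
      the normalisation. The indices m = 1, ..., N match the N interpolated coefficients.\<close>
    define u where "u = cscale C (zpow (- int ?N) * F)"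
    have "ess_bound u C"
      using ess_bound_cscale[OF ess_bound_mult[OF ess_bound_zpow F(2)], of C] C by (simp add: u_def)
    moreover have "fourier_coeff u (- int m) = of_real ((?N - m + 1) / ?N) * \<alpha> m" if "0 < m" "m \<le> ?N" for m
    proof -
      have "fourier_coeff u (- int m) = C * fourier_coeff F (int (?N - m))"
      proof -
        have "- int m - - int ?N = int (?N - m)" using that by linarith
        then show ?thesis by (simp only: u_def fourier_coeff_cscale fourier_coeff_zpow_mult)
      qed
      also have "\<dots> = C * f $ (?N - m)" using F(3)[of "?N - m"] that by simp
      also have "\<dots> = of_real ((?N - m + 1) / ?N) * \<alpha> m"
        using that C by (simp add: f_def field_simps del: of_nat_Suc)
      finally show ?thesis .
    qed
    ultimately show ?thesis by blast
  qed
  then obtain u where u: "\<And>N. ess_bound (u N) C" "\<And>N m. 0 < m \<Longrightarrow> m \<le> Suc N \<Longrightarrow>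
      fourier_coeff (u N) (- int m) = of_real ((Suc N - m + 1) / Suc N) * \<alpha> m" by metis
  obtain v r where r: "strict_mono (r :: nat \<Rightarrow> nat)" and v: "v \<in> L2" "ess_bound v C"
    "\<And>n. (\<lambda>k. fourier_coeff (u (r k)) n) \<longlonglongrightarrow> fourier_coeff v n"
    using weak_star_compact[of u C] u(1) C by auto
  have "fourier_coeff v (- int m) = \<alpha> m" if m: "m > 0" for m
  proof (rule LIMSEQ_unique[OF v(3)])
    have "(\<lambda>N. of_real ((real N + 2 - real m) / (real N + 1)) * \<alpha> m) \<longlonglongrightarrow> of_real 1 * \<alpha> m"
      by (intro tendsto_intros) real_asymp
    moreover have "\<forall>\<^sub>F N in sequentially. of_real ((real N + 2 - real m) / (real N + 1)) * \<alpha> m = fourier_coeff (u N) (- int m)"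
      using m by (intro eventually_sequentiallyI[of m]) (simp add: u(2) of_nat_diff add_ac)
    ultimately have "(\<lambda>N. fourier_coeff (u N) (- int m)) \<longlonglongrightarrow> \<alpha> m"
      by (subst (asm) tendsto_cong) auto
    then show "(\<lambda>k. fourier_coeff (u (r k)) (- int m)) \<longlonglongrightarrow> \<alpha> m"
      using LIMSEQ_subseq_LIMSEQ[OF _ r] by (auto simp: o_def)
  qed
  with v show ?thesis by blast
qed

section \<open>Model spaces\<close>

lemma cscale_diff: "cscale c (f - g) = cscale c f - cscale c g"
  by transfer (auto simp: ae_eq_def algebra_simps)

lemma inner_functionD:
  assumes "inner_function \<theta>"
  shows "\<theta> \<in> Hinf" "unimodular \<theta>" "conj_fun \<theta> * \<theta> = 1" "\<theta> * conj_fun \<theta> = 1" "ess_bound \<theta> 1"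
  using assms unimodular_mult_conj[of \<theta>] unimodular_ess_bound[of \<theta>]
  by (simp_all add: inner_function_def mult.commute)

lemma inner_conj_mult_L2: "inner_function \<theta> \<Longrightarrow> f \<in> L2 \<Longrightarrow> conj_fun \<theta> * f \<in> L2"
  by (rule ess_bound_L2_mult(1)[of _ 1]) (auto simp: inner_functionD(5))

lemma inner_mult_H2: "inner_function \<theta> \<Longrightarrow> f \<in> H2 \<Longrightarrow> \<theta> * f \<in> H2"
  by (rule Hinf_mult_H2[OF inner_functionD(1)])

lemma coord_mult_H2: "f \<in> H2 \<Longrightarrow> coord * f \<in> H2"
  by (rule Hinf_mult_H2[OF Hinf_coord])

lemma model_space_imp_H2: "f \<in> model_space \<theta> \<Longrightarrow> f \<in> H2"
  by (simp add: model_space_def orth_diff_def)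

lemma model_space_orthogonal:
  assumes "f \<in> model_space \<theta>" "h \<in> H2"
  shows "cinner f (\<theta> * h) = 0" "cinner (\<theta> * h) f = 0"
proof -
  show "cinner f (\<theta> * h) = 0"
    using assms by (simp add: model_space_def orth_diff_def mult_image_def)
  then show "cinner (\<theta> * h) f = 0"
    using cinner_commute[of "\<theta> * h" f] by simp
qed

lemma model_space_diff:
  assumes \<theta>: "inner_function \<theta>" and f: "f \<in> model_space \<theta>" and g: "g \<in> model_space \<theta>"
  shows "f - g \<in> model_space \<theta>"
proof -
  have "cinner (f - g) (\<theta> * h) = 0" if "h \<in> H2" for h
    using model_space_orthogonal(1)[OF f that] model_space_orthogonal(1)[OF g that]
      f g that inner_mult_H2[OF \<theta> that]
    by (simp add: cinner_diff_left model_space_imp_H2 H2_imp_L2)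
  then show ?thesis
    using f g by (simp add: model_space_def orth_diff_def mult_image_def H2_diff)
qed

text \<open>Resolves the definite description in \<open>orth_proj\<close> from a known witness: two
  candidates differ by an element of \<open>M\<close> orthogonal to itself.\<close>

lemma orth_proj_eqI:
  assumes M: "M \<subseteq> L2" "\<And>f g. f \<in> M \<Longrightarrow> g \<in> M \<Longrightarrow> f - g \<in> M"
    and f: "f \<in> L2" and g: "g \<in> M" "\<And>h. h \<in> M \<Longrightarrow> cinner (f - g) h = 0"
  shows "orth_proj M f = g"
  unfolding orth_proj_def
proof (rule the_equality)
  show "g \<in> M \<and> (\<forall>h\<in>M. cinner (f - g) h = 0)" using g by blast
next
  fix g' assume g': "g' \<in> M \<and> (\<forall>h\<in>M. cinner (f - g') h = 0)"
  define d where "d = g' - g"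
  have d: "d \<in> M" using M(2) g' g by (simp add: d_def)
  have L2: "f - g \<in> L2" "f - g' \<in> L2" "d \<in> L2"
    using M(1) f g' g d L2_diff by blast+
  have "d = (f - g) - (f - g')" by (simp add: d_def)
  then have "cinner d d = cinner ((f - g) - (f - g')) d" by (rule arg_cong)
  also have "\<dots> = cinner (f - g) d - cinner (f - g') d" using L2 by (intro cinner_diff_left)
  also have "\<dots> = 0" using g(2)[OF d] g' d by simp
  finally have "L2_norm d = 0" by (simp add: L2_norm_def)
  with L2 have "d = 0" by (intro L2_norm_eq_0)
  then show "g' = g" by (simp add: d_def)
qed

lemma orth_proj_model_space:
  assumes \<theta>: "inner_function \<theta>" and k: "k \<in> model_space \<theta>" and h: "h \<in> H2"
  shows "orth_proj (model_space \<theta>) (k + \<theta> * h) = k"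
proof (rule orth_proj_eqI[OF _ model_space_diff[OF \<theta>]])
  show "model_space \<theta> \<subseteq> L2" using model_space_imp_H2 H2_imp_L2 by blast
  show "k + \<theta> * h \<in> L2"
    using model_space_imp_H2[OF k] inner_mult_H2[OF \<theta> h] H2_add H2_imp_L2 by blast
qed (use k model_space_orthogonal(2)[OF _ h] in auto)

text \<open>Write f = \<theta> p with p in \<open>L2\<close> and let h be the analytic part of p.
  The rest p - h has only negative coefficients, so it is orthogonal to \<open>H2\<close>;
  multiplication by the unimodular \<theta> preserves this. All projections onto the model space are
  computed from this splitting.\<close>

lemma H2_decomposition:
  assumes \<theta>: "inner_function \<theta>" and f: "f \<in> H2"
  shows "\<exists>k\<in>model_space \<theta>. \<exists>h\<in>H2. f = k + \<theta> * h"
proof -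
  define p where "p = conj_fun \<theta> * f"
  have p: "p \<in> L2" "f = \<theta> * p"
    using inner_conj_mult_L2[OF \<theta>] f inner_functionD(4)[OF \<theta>]
    by (simp_all add: p_def H2_imp_L2 flip: mult.assoc)
  define c where "c n = (if n \<ge> 0 then fourier_coeff p n else 0)" for n
  have "(\<Sum>n\<in>{- int M..int M}. (cmod (c n))\<^sup>2) \<le> (L2_norm p)\<^sup>2" for M
    by (rule order_trans[OF sum_mono Bessel_inequality[OF p(1), of "{- int M..int M}"]]) (auto simp: c_def)
  then obtain h where h: "h \<in> L2" "\<And>n. fourier_coeff h n = c n"
    using Riesz_Fischer by blast
  have h2: "h \<in> H2" using h by (simp add: H2_iff c_def)
  have "cinner (f - \<theta> * h) (\<theta> * g) = 0" if g: "g \<in> H2" for g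
  proof -
    have "f - \<theta> * h = \<theta> * (p - h)" by (simp add: p(2) algebra_simps)
    then have "cinner (f - \<theta> * h) (\<theta> * g) = cinner (p - h) (conj_fun \<theta> * \<theta> * g)"
      by (simp add: cinner_mult_left mult.assoc)
    also have "\<dots> = cinner (p - h) g"
      by (simp add: inner_functionD(3)[OF \<theta>])
    also have "\<dots> = 0"
      using p h g by (intro cinner_eq_0) (auto simp: L2_diff H2_iff fourier_coeff_diff c_def)
    finally show ?thesis .
  qed
  then have "f - \<theta> * h \<in> model_space \<theta>"
    using f inner_mult_H2[OF \<theta> h2] by (simp add: model_space_def orth_diff_def mult_image_def H2_diff)
  with h2 show ?thesis
    by (intro bexI[of _ "f - \<theta> * h"] bexI[of _ h]) auto
qed

lemma restricted_shift_eq: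
  assumes \<eta>: "inner_function \<eta>" and h: "h \<in> mult_image \<eta> H2"
  shows "restricted_shift \<eta> h = coord * h" "coord * h \<in> mult_image \<eta> H2"
proof -
  show 1: "coord * h \<in> mult_image \<eta> H2"
  proof -
    obtain f where "f \<in> H2" "h = \<eta> * f" using h by (auto simp: mult_image_def)
    then have "coord * f \<in> H2" "coord * h = \<eta> * (coord * f)"
      by (simp_all add: coord_mult_H2 mult.left_commute)
    then show ?thesis by (auto simp: mult_image_def)
  qed
  have sub: "mult_image \<eta> H2 \<subseteq> L2"
    using inner_mult_H2[OF \<eta>] H2_imp_L2 by (auto simp: mult_image_def)
  show "restricted_shift \<eta> h = coord * h"
    unfolding restricted_shift_def shift_def
  proof (rule orth_proj_eqI[OF sub])
    fix f g assume "f \<in> mult_image \<eta> H2" "g \<in> mult_image \<eta> H2"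
    then obtain f' g' where "f = \<eta> * f'" "g = \<eta> * g'" "f' \<in> H2" "g' \<in> H2"
      by (auto simp: mult_image_def)
    then have "f - g = \<eta> * (f' - g')" "f' - g' \<in> H2" by (simp_all add: right_diff_distrib H2_diff)
    then show "f - g \<in> mult_image \<eta> H2" by (simp add: mult_image_def)
  qed (use 1 sub in auto)
qed

text \<open>Replaces the compressed shift by multiplication with z modulo
  \<open>\<theta> H\<^sup>2\<close>, so that later computations contain no projection.\<close>

lemma model_shift_decomposition:
  assumes \<theta>: "inner_function \<theta>" and k: "k \<in> model_space \<theta>"
  shows "model_shift \<theta> k \<in> model_space \<theta>" "\<exists>h\<in>H2. coord * k = model_shift \<theta> k + \<theta> * h"
proof -
  obtain k' h where *: "k' \<in> model_space \<theta>" "h \<in> H2" "coord * k = k' + \<theta> * h"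
    using H2_decomposition[OF \<theta> coord_mult_H2[OF model_space_imp_H2[OF k]]] by blast
  then have "model_shift \<theta> k = k'"
    using orth_proj_model_space[OF \<theta> *(1,2)] by (simp add: model_shift_def shift_def)
  with * show "model_shift \<theta> k \<in> model_space \<theta>" "\<exists>h\<in>H2. coord * k = model_shift \<theta> k + \<theta> * h"
    by auto
qed

text \<open>Both the intertwining hypothesis and the conclusion are stated modulo
  \<open>\<theta> H\<^sup>2\<close> and without \<open>orth_proj\<close>: the former says that
  \<open>B\<close> intertwines the shift with its compression, the latter that \<open>B g\<close> is
  the projection of \<open>\<psi> * g\<close>.\<close>

theorem Sarason:
  assumes \<theta>: "inner_function \<theta>"
    and B: "\<And>f. f \<in> H2 \<Longrightarrow> B f \<in> model_space \<theta>"
    and B_add: "\<And>f g. f \<in> H2 \<Longrightarrow> g \<in> H2 \<Longrightarrow> B (f + g) = B f + B g"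
    and B_cscale: "\<And>c f. f \<in> H2 \<Longrightarrow> B (cscale c f) = cscale c (B f)"
    and C: "C > 0" and B_bound: "\<And>f. f \<in> H2 \<Longrightarrow> L2_norm (B f) \<le> C * L2_norm f"
    and commute: "\<And>f. f \<in> H2 \<Longrightarrow> \<exists>h\<in>H2. coord * B f = B (coord * f) + \<theta> * h"
  shows "\<exists>\<psi>\<in>Hinf. \<forall>g\<in>H2. \<forall>k\<in>model_space \<theta>. cinner (\<psi> * g - B g) k = 0"
proof -
  have B_H2: "B f \<in> H2" "B f \<in> L2" if "f \<in> H2" for f
    using B[OF that] model_space_imp_H2 H2_imp_L2 by auto
  have B_0: "B 0 = 0" using B_cscale[of 0 0] by simp
  have zn: "zpow (int n) \<in> H2" for n by (simp add: H2_zpow)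
  have B_sum: "(\<Sum>i\<in>I. f i) \<in> H2 \<and> B (\<Sum>i\<in>I. f i) = (\<Sum>i\<in>I. B (f i))" if "\<And>i. i \<in> I \<Longrightarrow> f i \<in> H2" for f :: "nat \<Rightarrow> circle_fun" and I
    using that by (induction I rule: infinite_finite_induct) (auto simp: B_0 B_add H2_add)
  \<comment> \<open>Elements of \<open>\<theta> H\<^sup>2\<close> become elements of
    \<open>H2\<close>, so the negative coefficients of \<open>L f\<close> do not see the error in
    the intertwining relation.\<close>
  define L where "L f = conj_fun \<theta> * B f" for f
  have L_L2: "L f \<in> L2" if "f \<in> H2" for f
    unfolding L_def by (rule inner_conj_mult_L2[OF \<theta> B_H2(2)[OF that]])
  have L_shift: "fourier_coeff (L (coord * f)) (- int (Suc m)) = fourier_coeff (L f) (- int (Suc (Suc m)))"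
    if f: "f \<in> H2" for f m
  proof -
    obtain h where h: "h \<in> H2" "coord * B f = B (coord * f) + \<theta> * h" using commute[OF f] by blast
    have "B (coord * f) = coord * B f - \<theta> * h" using h(2) by simp
    then have "L (coord * f) = conj_fun \<theta> * (coord * B f - \<theta> * h)" by (simp only: L_def)
    also have "\<dots> = zpow 1 * L f - (conj_fun \<theta> * \<theta>) * h"
      by (simp add: L_def coord_eq_zpow right_diff_distrib mult_ac)
    finally have eq: "L (coord * f) = zpow 1 * L f - h" by (simp add: inner_functionD(3)[OF \<theta>])
    have L2: "zpow 1 * L f \<in> L2" by (rule ess_bound_L2_mult(1)[OF ess_bound_zpow L_L2[OF f]]) simp
    show ?thesis
      unfolding eq using L2 h(1) by (simp add: fourier_coeff_diff fourier_coeff_zpow_mult H2_iff)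
  qed
  define \<alpha> where "\<alpha> m = fourier_coeff (L 1) (- int m)" for m
  \<comment> \<open>The row index starts at the coefficient -1, whence the summand 1 in the argument
    of \<alpha>; constancy along i + j is the iterated shift relation.\<close>
  have hankel_entry: "fourier_coeff (L (zpow (int j))) (- int (Suc i)) = \<alpha> (j + i + 1)" for i j
  proof (induction j arbitrary: i)
    case 0
    show ?case by (simp add: \<alpha>_def)
  next
    case (Suc j)
    have "zpow (int (Suc j)) = coord * zpow (int j)" by (simp add: coord_eq_zpow zpow_add)
    then have "fourier_coeff (L (zpow (int (Suc j)))) (- int (Suc i)) = fourier_coeff (L (zpow (int j))) (- int (Suc (Suc i)))"
      using L_shift[OF zn] by (simp only:)
    also have "\<dots> = \<alpha> (j + Suc i + 1)" by (rule Suc)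
    finally show ?case by simp
  qed
  have hankel: "cmod (\<Sum>j<N. \<Sum>i<N. x j * y i * \<alpha> (j + i + 1)) \<le>
      C * sqrt (\<Sum>j<N. (cmod (x j))\<^sup>2) * sqrt (\<Sum>i<N. (cmod (y i))\<^sup>2)" for N x y
  proof -
    define p where "p = (\<Sum>j<N. cscale (x j) (zpow (int j)))"
    \<comment> \<open>The conjugated coefficients compensate for the conjugate linearity of
      \<open>cinner\<close> in its second argument, and the strictly negative exponents select the
      Hankel part of \<open>L p\<close>.\<close>
    define q where "q = (\<Sum>i<N. cscale (cnj (y i)) (zpow (- int (Suc i))))"
    have norm: "L2_norm (\<Sum>j<N. cscale (c j) (zpow (s j))) = sqrt (\<Sum>j<N. (cmod (c j))\<^sup>2)" if "inj s" for c s
    proof -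
      have "(\<Sum>j<N. cscale (c j) (zpow (s j))) = trig_poly (c \<circ> inv s) (s ` {..<N})"
        using that by (simp add: trig_poly_def sum.reindex inj_on_subset[OF that])
      then have "(L2_norm (\<Sum>j<N. cscale (c j) (zpow (s j))))\<^sup>2 = (\<Sum>j<N. (cmod (c j))\<^sup>2)"
        using that by (simp add: L2_norm_trig_poly sum.reindex inj_on_subset[OF that])
      then show ?thesis by (metis L2_norm_nonneg real_sqrt_unique)
    qed
    have p: "p \<in> H2" "L2_norm p = sqrt (\<Sum>j<N. (cmod (x j))\<^sup>2)"
      using B_sum[of "{..<N}" "\<lambda>j. cscale (x j) (zpow (int j))"] norm[of int x]
      by (simp_all add: p_def H2_cscale zn)
    have q: "q \<in> L2" "L2_norm q = sqrt (\<Sum>j<N. (cmod (y j))\<^sup>2)"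
      using norm[of "\<lambda>i. - int (Suc i)" "\<lambda>i. cnj (y i)"] by (simp_all add: q_def L2_sum L2_cscale inj_def)
    have "L p = (\<Sum>j<N. cscale (x j) (L (zpow (int j))))"
      using B_sum[of "{..<N}" "\<lambda>j. cscale (x j) (zpow (int j))"]
      by (simp add: p_def L_def B_cscale H2_cscale zn sum_distrib_left)
    then have "cinner (L p) (zpow n) = (\<Sum>j<N. x j * fourier_coeff (L (zpow (int j))) n)" for n
      by (simp add: cinner_sum_left L2_cscale L_L2 zn cinner_cscale_left fourier_coeff_eq_cinner)
    then have "cinner (L p) q = (\<Sum>i<N. \<Sum>j<N. x j * y i * \<alpha> (j + i + 1))"
      using L_L2[OF p(1)] unfolding q_def
      by (simp add: cinner_sum_right L2_cscale cinner_cscale_right hankel_entry[simplified] sum_distrib_left mult_ac)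
    then have "(\<Sum>j<N. \<Sum>i<N. x j * y i * \<alpha> (j + i + 1)) = cinner (L p) q"
      by (subst sum.swap) simp
    also have "cmod \<dots> \<le> L2_norm (L p) * L2_norm q"
      by (rule cinner_Cauchy_Schwarz[OF L_L2[OF p(1)] q(1)])
    also have "\<dots> \<le> (C * L2_norm p) * L2_norm q"
    proof (intro mult_right_mono)
      have "L2_norm (L p) \<le> 1 * L2_norm (B p)"
        unfolding L_def by (rule ess_bound_L2_mult(2)) (auto simp: inner_functionD(5)[OF \<theta>] B_H2 p)
      then show "L2_norm (L p) \<le> C * L2_norm p" using B_bound[OF p(1)] by simp
    qed simp
    finally show ?thesis by (simp add: p(2) q(2))
  qed
  obtain u where u: "u \<in> L2" "ess_bound u C" "\<And>m. m > 0 \<Longrightarrow> fourier_coeff u (- int m) = \<alpha> m"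
    using Nehari[OF C hankel] by blast
  define \<psi> where "\<psi> = \<theta> * u"
  \<comment> \<open>By the choice of \<alpha> the negative coefficients of \<open>u\<close> and
    \<open>L 1\<close> agree, so the difference is analytic.\<close>
  define w where "w = u - L 1"
  have one: "1 \<in> H2" using zn[of 0] by simp
  have w: "w \<in> H2"
    unfolding H2_iff
  proof (intro conjI allI impI)
    show "w \<in> L2" using u L_L2[OF one] by (simp add: w_def L2_diff)
    fix n :: int assume "n < 0"
    then obtain m where m: "n = - int m" "m > 0" by (metis neg_int_cases)
    then show "fourier_coeff w n = 0"
      using u L_L2[OF one] by (simp add: w_def fourier_coeff_diff \<alpha>_def)
  qed
  \<comment> \<open>This puts \<psi> into \<open>H2\<close>, although \<open>u\<close> need not be
    analytic, and it shows that multiplication by \<psi> agrees with \<open>B\<close> at 1 modulo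
    \<open>\<theta> H\<^sup>2\<close>.\<close>
  have \<psi>_eq: "\<psi> = B 1 + \<theta> * w"
    by (simp add: \<psi>_def w_def L_def right_diff_distrib inner_functionD(4)[OF \<theta>] flip: mult.assoc)
  have \<psi>_bound: "ess_bound \<psi> C"
    unfolding \<psi>_def using ess_bound_mult[OF inner_functionD(5)[OF \<theta>] u(2)] by simp
  have \<psi>: "\<psi> \<in> Hinf"
    using \<psi>_eq B_H2[OF one] inner_mult_H2[OF \<theta> w] \<psi>_bound C by (intro HinfI[of _ C]) (auto intro: H2_add)
  have mono: "\<exists>h\<in>H2. \<psi> * zpow (int n) = B (zpow (int n)) + \<theta> * h" for n
  proof (induction n)
    case 0
    show ?case using w \<psi>_eq by auto
  next
    case (Suc n)
    then obtain h where h: "h \<in> H2" "\<psi> * zpow (int n) = B (zpow (int n)) + \<theta> * h" by blast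
    obtain h' where h': "h' \<in> H2" "coord * B (zpow (int n)) = B (coord * zpow (int n)) + \<theta> * h'"
      using commute[OF zn] by blast
    have z: "zpow (int (Suc n)) = coord * zpow (int n)" by (simp add: coord_eq_zpow zpow_add)
    have "\<psi> * zpow (int (Suc n)) = coord * (\<psi> * zpow (int n))" by (simp only: z mult_ac)
    also have "\<dots> = B (zpow (int (Suc n))) + \<theta> * (h' + coord * h)"
      unfolding h(2) z by (simp add: distrib_left h'(2) mult_ac)
    finally show ?case using H2_add[OF h'(1) coord_mult_H2[OF h(1)]] by blast
  qed
  have "cinner (\<psi> * g - B g) k = 0" if g: "g \<in> H2" and k: "k \<in> model_space \<theta>" for g k
  proof -
    have kL2: "k \<in> L2" using k model_space_imp_H2 H2_imp_L2 by blast
    \<comment> \<open>On powers of z the defect lies in \<open>\<theta> H\<^sup>2\<close> and is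
      orthogonal to \<open>k\<close>. Its norm bound 2 C, one C from \<psi> and one from
      \<open>B\<close>, carries this from polynomials to all of \<open>H2\<close>.\<close>
    define D where "D f = \<psi> * f - B f" for f
    have D: "D f \<in> L2" "L2_norm (D f) \<le> 2 * C * L2_norm f" if "f \<in> H2" for f
    proof -
      have *: "\<psi> * f \<in> L2" "L2_norm (\<psi> * f) \<le> C * L2_norm f"
        using ess_bound_L2_mult[OF \<psi>_bound H2_imp_L2[OF that]] C by auto
      show "D f \<in> L2" using * B_H2[OF that] by (simp add: D_def L2_diff)
      have "L2_norm (D f) \<le> L2_norm (\<psi> * f - 0) + L2_norm (0 - B f)"
        unfolding D_def using * B_H2[OF that] by (intro L2_norm_triangle_diff) auto
      also have "L2_norm (0 - B f) = L2_norm (B f)" using L2_norm_diff_commute[of 0 "B f"] by simp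
      finally show "L2_norm (D f) \<le> 2 * C * L2_norm f" using * B_bound[OF that] by simp
    qed
    define p where "p M = trig_poly (fourier_coeff g) {- int M..int M}" for M
    \<comment> \<open>Since \<open>g\<close> is analytic, its symmetric partial sums are polynomials
      in z, to which the relation for powers applies.\<close>
    have p_eq: "p M = (\<Sum>n\<le>M. cscale (fourier_coeff g (int n)) (zpow (int n)))" for M
    proof -
      have "p M = (\<Sum>n\<in>{int 0..int M}. cscale (fourier_coeff g n) (zpow n))"
        unfolding p_def trig_poly_def using g by (intro sum.mono_neutral_right) (auto simp: H2_iff)
      also have "\<dots> = (\<Sum>n\<in>{0..M}. cscale (fourier_coeff g (int n)) (zpow (int n)))"
        by (subst sum.atLeast_int_atMost_int_shift) simp
      finally show ?thesis by (simp add: atMost_atLeast0)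
    qed
    have pH2: "p M \<in> H2" and Bp: "B (p M) = (\<Sum>n\<le>M. cscale (fourier_coeff g (int n)) (B (zpow (int n))))" for M
      using B_sum[of "{..M}" "\<lambda>n. cscale (fourier_coeff g (int n)) (zpow (int n))"]
      by (simp_all add: p_eq H2_cscale zn B_cscale)
    have Dz: "cinner (D (zpow (int n))) k = 0" for n
      using mono[of n] model_space_orthogonal(2)[OF k] by (auto simp: D_def)
    have Dp: "cinner (D (p M)) k = 0" for M
    proof -
      have "D (p M) = (\<Sum>n\<le>M. cscale (fourier_coeff g (int n)) (D (zpow (int n))))"
        unfolding D_def Bp by (simp add: p_eq sum_distrib_left cscale_diff flip: sum_subtractf)
      then show ?thesis
        by (simp add: cinner_sum_left L2_cscale D zn kL2 cinner_cscale_left Dz)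
    qed
    have "cmod (cinner (D g) k) \<le> 2 * C * L2_norm (p M - g) * L2_norm k" for M
    proof -
      have d: "g - p M \<in> H2" using g pH2 by (rule H2_diff)
      have "B (g - p M + p M) = B (g - p M) + B (p M)" by (rule B_add[OF d pH2])
      then have "D g = D (g - p M) + D (p M)" by (simp add: D_def algebra_simps)
      then have "cinner (D g) k = cinner (D (g - p M)) k"
        using D(1)[OF d] D(1)[OF pH2] kL2 Dp by (simp add: cinner_add_left)
      also have "cmod \<dots> \<le> L2_norm (D (g - p M)) * L2_norm k"
        by (rule cinner_Cauchy_Schwarz[OF D(1)[OF d] kL2])
      also have "\<dots> \<le> 2 * C * L2_norm (g - p M) * L2_norm k"
        by (intro mult_right_mono D(2)[OF d]) simp
      finally show ?thesis by (simp add: L2_norm_diff_commute)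
    qed
    moreover have "(\<lambda>M. 2 * C * L2_norm (p M - g) * L2_norm k) \<longlonglongrightarrow> 2 * C * 0 * L2_norm k"
      unfolding p_def by (intro tendsto_intros fourier_series_tendsto H2_imp_L2[OF g])
    ultimately have "cmod (cinner (D g) k) \<le> 2 * C * 0 * L2_norm k"
      by (intro LIMSEQ_le_const) auto
    then show ?thesis by (simp add: D_def)
  qed
  with \<psi> show ?thesis by blast
qed

theorem theorem1p4:
  fixes \<eta> \<theta> :: circle_fun and A :: "circle_fun \<Rightarrow> circle_fun"
  assumes "inner_function \<eta>" and "inner_function \<theta>"
    and "bounded_operator (mult_image \<eta> H2) (model_space \<theta>) A"
  shows "(\<forall>h \<in> mult_image \<eta> H2. A (restricted_shift \<eta> h) = model_shift \<theta> (A h)) \<longleftrightarrow>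
    (\<exists>\<phi> \<in> mult_image (conj_fun \<eta>) Hinf. \<forall>h \<in> mult_image \<eta> H2. A h = restricted_toeplitz \<theta> \<phi> h)"
    (is "?intertwining \<longleftrightarrow> ?toeplitz")
proof
  note \<eta> = assms(1) and \<theta> = assms(2)
  have dom: "\<eta> * f \<in> mult_image \<eta> H2" if "f \<in> H2" for f
    using that by (simp add: mult_image_def)
  \<comment> \<open>The conjugate of \<eta> in the symbol cancels the \<eta> of the domain; this is
    why the symbols range over \<open>mult_image (conj_fun \<eta>) Hinf\<close>.\<close>
  have cancel: "(conj_fun \<eta> * \<psi>) * (\<eta> * g) = \<psi> * g" for \<psi> g
  proof -
    have "(conj_fun \<eta> * \<psi>) * (\<eta> * g) = (conj_fun \<eta> * \<eta>) * (\<psi> * g)" by (simp only: mult_ac)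
    then show ?thesis by (simp add: inner_functionD(3)[OF \<eta>])
  qed
  {
    assume int: ?intertwining
    define B where "B f = A (\<eta> * f)" for f
    have B: "B f \<in> model_space \<theta>" if "f \<in> H2" for f
      using assms(3) dom[OF that] by (simp add: bounded_operator_def B_def)
    have B_add: "B (f + g) = B f + B g" if "f \<in> H2" "g \<in> H2" for f g
      using assms(3) dom that by (simp add: bounded_operator_def B_def distrib_left)
    have B_cscale: "B (cscale c f) = cscale c (B f)" if "f \<in> H2" for c f
      using assms(3) dom that by (simp add: bounded_operator_def B_def)
    obtain C where C: "\<And>h. h \<in> mult_image \<eta> H2 \<Longrightarrow> L2_norm (A h) \<le> C * L2_norm h"
      using assms(3) unfolding bounded_operator_def by blast
    \<comment> \<open>The constant in \<open>bounded_operator\<close> carries no sign, while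
      \<open>Sarason\<close> asks for a positive one, by which the Fejer averages are
      divided.\<close>
    have B_bound: "L2_norm (B f) \<le> max C 1 * L2_norm f" if "f \<in> H2" for f
    proof -
      have "L2_norm (B f) \<le> C * L2_norm f"
        using C[OF dom[OF that]] by (simp add: B_def unimodular_L2_norm inner_functionD(2)[OF \<eta>])
      also have "\<dots> \<le> max C 1 * L2_norm f" by (intro mult_right_mono) auto
      finally show ?thesis .
    qed
    have commute: "\<exists>h\<in>H2. coord * B f = B (coord * f) + \<theta> * h" if "f \<in> H2" for f
    proof -
      have "B (coord * f) = model_shift \<theta> (B f)"
        using int[rule_format, OF dom[OF that]] restricted_shift_eq(1)[OF \<eta> dom[OF that]]
        by (simp add: B_def mult.left_commute[of \<eta> coord])
      then show ?thesis using model_shift_decomposition(2)[OF \<theta> B[OF that]] by simp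
    qed
    obtain \<psi> where \<psi>: "\<psi> \<in> Hinf" "\<And>g k. g \<in> H2 \<Longrightarrow> k \<in> model_space \<theta> \<Longrightarrow> cinner (\<psi> * g - B g) k = 0"
      using Sarason[OF \<theta> B B_add B_cscale _ B_bound commute] by (auto simp: less_max_iff_disj)
    have "A h = restricted_toeplitz \<theta> (conj_fun \<eta> * \<psi>) h" if h: "h \<in> mult_image \<eta> H2" for h
    proof -
      obtain g where g: "g \<in> H2" "h = \<eta> * g" using h by (auto simp: mult_image_def)
      have "orth_proj (model_space \<theta>) (\<psi> * g) = B g"
      proof (rule orth_proj_eqI[OF _ model_space_diff[OF \<theta>]])
        show "model_space \<theta> \<subseteq> L2" using model_space_imp_H2 H2_imp_L2 by blast
        show "\<psi> * g \<in> L2" using Hinf_mult_H2[OF \<psi>(1) g(1)] H2_imp_L2 by blast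
      qed (use B \<psi>(2) g(1) in auto)
      then show ?thesis
        unfolding restricted_toeplitz_def g(2) cancel B_def by simp
    qed
    then show ?toeplitz using \<psi>(1) by (auto simp: mult_image_def)
  }
  {
    assume ?toeplitz
    then obtain \<psi> where \<psi>: "\<psi> \<in> Hinf" 
      and A: "\<And>h. h \<in> mult_image \<eta> H2 \<Longrightarrow> A h = restricted_toeplitz \<theta> (conj_fun \<eta> * \<psi>) h"
      by (auto simp: mult_image_def)
    have A': "A (\<eta> * g) = orth_proj (model_space \<theta>) (\<psi> * g)" if "g \<in> H2" for g
      using A[OF dom[OF that]] unfolding restricted_toeplitz_def cancel .
    show ?intertwining
    proof
      fix h assume h: "h \<in> mult_image \<eta> H2"
      then obtain g where g: "g \<in> H2" "h = \<eta> * g" by (auto simp: mult_image_def)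
      obtain k h1 where k: "k \<in> model_space \<theta>" "h1 \<in> H2" "\<psi> * g = k + \<theta> * h1"
        using H2_decomposition[OF \<theta> Hinf_mult_H2[OF \<psi> g(1)]] by blast
      have Ah: "A h = k"
        using A'[OF g(1)] orth_proj_model_space[OF \<theta> k(1,2)] by (simp add: g(2) k(3))
      obtain h2 where h2: "h2 \<in> H2" "coord * k = model_shift \<theta> k + \<theta> * h2"
        using model_shift_decomposition(2)[OF \<theta> k(1)] by blast
      \<comment> \<open>Multiplication by \<psi> commutes with z, and multiplying the error
        \<open>\<theta> * h1\<close> by z leaves it in \<open>\<theta> H\<^sup>2\<close>; hence
        projecting before or after the shift gives the same result.\<close>
      have "\<psi> * (coord * g) = coord * (\<psi> * g)" by (simp add: mult_ac)
      also have "\<dots> = model_shift \<theta> k + \<theta> * (h2 + coord * h1)"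
        unfolding k(3) by (simp add: distrib_left h2(2) mult_ac)
      finally have "A (\<eta> * (coord * g)) = model_shift \<theta> k"
        using A'[OF coord_mult_H2[OF g(1)]] 
          orth_proj_model_space[OF \<theta> model_shift_decomposition(1)[OF \<theta> k(1)] H2_add[OF h2(1) coord_mult_H2[OF k(2)]]]
        by simp
      then show "A (restricted_shift \<eta> h) = model_shift \<theta> (A h)"
        using restricted_shift_eq(1)[OF \<eta> h] Ah by (simp add: g(2) mult.left_commute[of \<eta> coord])
    qed
  }
qed

end
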